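(* Let $f:\mathbb{R}^n\to\overline{\mathbb{R}}$ be proper and lower semicontinuous and let $g_i:\mathbb{R}^n\to\mathbb{R}$ be $C^1$ for $i=1,\ldots,p$. Consider the problem $$\min_{x\in\mathbb{R}^n} f(x)\quad\text{s.t.}\quad g_i(x)\le0,\ i=1,\ldots,m,\qquad g_i(x)=0,\ i=m+1,\ldots,p.$$ Let $G=(g_1,\ldots,g_p)$, let $C=\{u\in\mathbb{R}^p: u_i\le0\ \forall i=1,\ldots,m,\ u_i=0\ \forall i=m+1,\ldots,p\}$, and let $\varphi(x)=f(x)+\delta_C(G(x))$. Let $\bar x\in\mathbb{R}^n$ be a critical point of the problem, that is, $0\in\partial\varphi(\bar x)$. Let $\mathcal A(\bar x)=\{1\le i\le m: g_i(\bar x)=0\}$ and $\mathcal J(\bar x)=\mathcal A(\bar x)\cup\{m+1,\ldots,p\}$. Suppose that: (i) $f$ is variationally convex at $\bar x$ for every $\bar v\in\partial f(\bar x)$ with $-\bar v\in\nabla G(\bar x)^*N_C(G(\bar x))$; (ii) the positive linear independence constraint qualification holds at $\bar x$, i.e. $$\Big[\sum_{i\in\mathcal J(\bar x)}u_i\nabla g_i(\bar x)=0\ \text{ and }\ u_i\ge0\ \forall i\in\mathcal A(\bar x)\Big]\ \Rightarrow\ [u_i=0\ \forall i\in\mathcal J(\bar x)],$$ and $$\partial^\infty f(\bar x)\cap\left(-\nabla G(\bar x)^*N_C(G(\bar x))\right)=\{0\};$$ (iii) for every $i\in\mathcal A(\bar x)$, $g_i$ is locally convex around $\bar x$, and for every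 $m+1\le i\le p$, $g_i$ is affine. Then $\varphi$ is variationally convex at $\bar x$ for $0\in\partial\varphi(\bar x)$. Consequently, $\bar x$ is a local minimizer of the problem.
   Context: $\overline{\mathbb{R}}=[-\infty,+\infty]$; $f$ is proper if $f>-\infty$ and $f\not\equiv+\infty$; $\operatorname{dom} f=\{x: f(x)<+\infty\}$; $\delta_C$ is the indicator function of $C$ ($0$ on $C$, $+\infty$ off $C$); $N_C$ is the normal cone of the convex set $C$; $\nabla G(x)^*$ is the transpose of the Jacobian of $G$. "Locally convex around $\bar x$" means convex on some open convex neighborhood of $\bar x$. For $\bar x\in\operatorname{dom}f$: the regular subdifferential is $\widehat\partial f(\bar x)=\{v:\liminf_{x\to\bar x,\,x\ne\bar x}\frac{f(x)-f(\bar x)-\langle v,x-\bar x\rangle}{\|x-\bar x\|}\ge0\}$; the limiting subdifferential $\partial f(\bar x)$ is the set of limits $v=\lim v_k$ with $v_k\in\widehat\partial f(x_k)$, $x_k\to\bar x$, $f(x_k)\to f(\bar x)$; the horizon subdifferential $\partial^\infty f(\bar x)$ is the set of limits $v=\lim\lambda_kv_k$ with $\lambda_k\downarrow0$, $v_k\in\widehat\partial f(x_k)$, $x_k\to\bar x$, $f(x_k)\to f(\bar x)$. Subdifferentials are empty off $\operatorname{dom}f$. $\operatorname{gph}\partial f=\{(x,v): v\in\partial f(x)\}$. Variational convexity: a proper lsc $f$ is variationally convex at $\bar x\in\operatorname{dom}f$ for $\bar v\in\partial f(\bar x)$ if there exist open convex neighborhoods $U$ of $\bar x$ and $V$ of $\bar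 v$, a convex lsc function $\hat f:\mathbb{R}^n\to\overline{\mathbb{R}}$ with $\hat f\le f$ on $U$, and $\varepsilon>0$ such that $[U_\varepsilon\times V]\cap\operatorname{gph}\partial f=[U\times V]\cap\operatorname{gph}\partial\hat f$, where $U_\varepsilon=\{x\in U: f(x)<f(\bar x)+\varepsilon\}$, and moreover $f(x)=\hat f(x)$ for every $(x,v)$ in this common graph. *)

theory Defs
  imports "HOL-Analysis.Analysis"
begin

section \<open>Extended-real-valued functions\<close>

definition proper_fun :: "('a \<Rightarrow> ereal) \<Rightarrow> bool" where
  "proper_fun f \<longleftrightarrow> (\<forall>x. f x > -\<infinity>) \<and> (\<exists>x. f x \<noteq> \<infinity>)"

definition dom_fun :: "('a \<Rightarrow> ereal) \<Rightarrow> 'a set" where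
  "dom_fun f = {x. f x < \<infinity>}"

definition lsc_fun :: "('a::topological_space \<Rightarrow> ereal) \<Rightarrow> bool" where
  "lsc_fun f \<longleftrightarrow> (\<forall>x. f x \<le> Liminf (nhds x) f)"

definition convex_fun :: "('a::real_vector \<Rightarrow> ereal) \<Rightarrow> bool" where
  "convex_fun f \<longleftrightarrow> convex {(x, t::real). f x \<le> ereal t}"

definition indicator_inf :: "'a set \<Rightarrow> 'a \<Rightarrow> ereal" where
  "indicator_inf C x = (if x \<in> C then 0 else \<infinity>)"

section \<open>Subdifferentials and normal cone\<close>

text \<open>All subdifferentials are empty at points where the function is not finite. For functions
  that nowhere take the value \<open>-\<infinity>\<close> this just says that they are empty off the domain; at a point
  of value \<open>-\<infinity>\<close> the difference quotient is meaningless.\<close>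

definition regular_subdiff :: "('a::euclidean_space \<Rightarrow> ereal) \<Rightarrow> 'a \<Rightarrow> 'a set" where
  "regular_subdiff f x = {v. \<bar>f x\<bar> \<noteq> \<infinity> \<and>
     Liminf (at x) (\<lambda>y. (f y - f x - ereal (v \<bullet> (y - x))) / ereal (norm (y - x))) \<ge> 0}"

definition limiting_subdiff :: "('a::euclidean_space \<Rightarrow> ereal) \<Rightarrow> 'a \<Rightarrow> 'a set" where
  "limiting_subdiff f x = {v. \<bar>f x\<bar> \<noteq> \<infinity> \<and>
     (\<exists>(X :: nat \<Rightarrow> 'a) V. (\<forall>k. V k \<in> regular_subdiff f (X k)) \<and>
        X \<longlonglongrightarrow> x \<and> (\<lambda>k. f (X k)) \<longlonglongrightarrow> f x \<and> V \<longlonglongrightarrow> v)}"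

definition horizon_subdiff :: "('a::euclidean_space \<Rightarrow> ereal) \<Rightarrow> 'a \<Rightarrow> 'a set" where
  "horizon_subdiff f x = {v. \<bar>f x\<bar> \<noteq> \<infinity> \<and>
     (\<exists>(X :: nat \<Rightarrow> 'a) V (\<mu> :: nat \<Rightarrow> real). (\<forall>k. V k \<in> regular_subdiff f (X k)) \<and>
        X \<longlonglongrightarrow> x \<and> (\<lambda>k. f (X k)) \<longlonglongrightarrow> f x \<and>
        (\<forall>k. \<mu> k > 0) \<and> \<mu> \<longlonglongrightarrow> 0 \<and> (\<lambda>k. \<mu> k *\<^sub>R V k) \<longlonglongrightarrow> v)}"

definition gph_subdiff :: "('a::euclidean_space \<Rightarrow> ereal) \<Rightarrow> ('a \<times> 'a) set" where
  "gph_subdiff f = {(x, v). v \<in> limiting_subdiff f x}"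

text \<open>Normal cone in the sense of convex analysis, empty off the set.\<close>

definition normal_cone :: "'a::euclidean_space set \<Rightarrow> 'a \<Rightarrow> 'a set" where
  "normal_cone C u = {w. u \<in> C \<and> (\<forall>c\<in>C. w \<bullet> (c - u) \<le> 0)}"

section \<open>Variational convexity\<close>

definition variationally_convex :: "('a::euclidean_space \<Rightarrow> ereal) \<Rightarrow> 'a \<Rightarrow> 'a \<Rightarrow> bool" where
  "variationally_convex f x0 v0 \<longleftrightarrow>
     proper_fun f \<and> lsc_fun f \<and> x0 \<in> dom_fun f \<and> v0 \<in> limiting_subdiff f x0 \<and>
     (\<exists>U V fh \<epsilon>.
        open U \<and> convex U \<and> x0 \<in> U \<and> open V \<and> convex V \<and> v0 \<in> V \<and>
        convex_fun fh \<and> lsc_fun fh \<and> (\<forall>x\<in>U. fh x \<le> f x) \<and> (\<epsilon>::real) > 0 \<and>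
        ({x \<in> U. f x < f x0 + ereal \<epsilon>} \<times> V) \<inter> gph_subdiff f = (U \<times> V) \<inter> gph_subdiff fh \<and>
        (\<forall>(x, v) \<in> (U \<times> V) \<inter> gph_subdiff fh. f x = fh x))"

section \<open>Smooth and locally convex functions\<close>

definition gradient :: "('a::real_inner \<Rightarrow> real) \<Rightarrow> 'a \<Rightarrow> 'a" where
  "gradient h x = (THE D. GDERIV h x :> D)"

definition C1_fun :: "('a::real_inner \<Rightarrow> real) \<Rightarrow> bool" where
  "C1_fun h \<longleftrightarrow> (\<forall>x. GDERIV h x :> gradient h x) \<and> continuous_on UNIV (gradient h)"

definition locally_convex_around :: "('a::euclidean_space \<Rightarrow> real) \<Rightarrow> 'a \<Rightarrow> bool" where
  "locally_convex_around h x \<longleftrightarrow> (\<exists>U. open U \<and> convex U \<and> x \<in> U \<and> convex_on U h)"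

definition affine_fun :: "('a::euclidean_space \<Rightarrow> real) \<Rightarrow> bool" where
  "affine_fun h \<longleftrightarrow> (\<exists>a b. \<forall>x. h x = a \<bullet> x + b)"

section \<open>The constrained problem\<close>

text \<open>The constraints are indexed by the finite type \<open>'p\<close>. The set \<open>I\<close> holds the indices of the
  inequality constraints (the indices \<open>1, \<dots>, m\<close>) and its complement \<open>- I\<close> those of the equality
  constraints (the indices \<open>m+1, \<dots>, p\<close>); either may be empty.\<close>

definition constraint_map :: "('p::finite \<Rightarrow> real^'n \<Rightarrow> real) \<Rightarrow> real^'n \<Rightarrow> real^'p" where
  "constraint_map g x = (\<chi> i. g i x)"

definition constraint_cone :: "'p::finite set \<Rightarrow> (real^'p) set" where
  "constraint_cone I = {u. (\<forall>i\<in>I. u $ i \<le> 0) \<and> (\<forall>i\<in>- I. u $ i = 0)}"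

definition constrained_objective ::
  "(real^'n \<Rightarrow> ereal) \<Rightarrow> ('p::finite \<Rightarrow> real^'n \<Rightarrow> real) \<Rightarrow> 'p set \<Rightarrow> real^'n \<Rightarrow> ereal" where
  "constrained_objective f g I x = f x + indicator_inf (constraint_cone I) (constraint_map g x)"

definition normal_image ::
  "('p::finite \<Rightarrow> real^'n \<Rightarrow> real) \<Rightarrow> 'p set \<Rightarrow> real^'n \<Rightarrow> (real^'n) set" where
  "normal_image g I x =
     (\<lambda>w. transpose (jacobian (constraint_map g) (at x)) *v w) `
       normal_cone (constraint_cone I) (constraint_map g x)"

definition active_ineqs :: "('p::finite \<Rightarrow> real^'n \<Rightarrow> real) \<Rightarrow> 'p set \<Rightarrow> real^'n \<Rightarrow> 'p set" where
  "active_ineqs g I x = {i \<in> I. g i x = 0}"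

definition active_constraints ::
  "('p::finite \<Rightarrow> real^'n \<Rightarrow> real) \<Rightarrow> 'p set \<Rightarrow> real^'n \<Rightarrow> 'p set" where
  "active_constraints g I x = active_ineqs g I x \<union> - I"

definition positive_LICQ :: "('p::finite \<Rightarrow> real^'n \<Rightarrow> real) \<Rightarrow> 'p set \<Rightarrow> real^'n \<Rightarrow> bool" where
  "positive_LICQ g I x \<longleftrightarrow>
     (\<forall>u :: 'p \<Rightarrow> real.
        (\<Sum>i\<in>active_constraints g I x. u i *\<^sub>R gradient (g i) x) = 0 \<and>
        (\<forall>i\<in>active_ineqs g I x. u i \<ge> 0)
        \<longrightarrow> (\<forall>i\<in>active_constraints g I x. u i = 0))"

definition feasible_set :: "('p::finite \<Rightarrow> real^'n \<Rightarrow> real) \<Rightarrow> 'p set \<Rightarrow> (real^'n) set" where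
  "feasible_set g I = {x. (\<forall>i\<in>I. g i x \<le> 0) \<and> (\<forall>i\<in>- I. g i x = 0)}"

definition local_minimizer_on :: "('a::topological_space \<Rightarrow> ereal) \<Rightarrow> 'a set \<Rightarrow> 'a \<Rightarrow> bool" where
  "local_minimizer_on f S x0 \<longleftrightarrow>
     x0 \<in> S \<and> x0 \<in> dom_fun f \<and> (\<exists>U. open U \<and> x0 \<in> U \<and> (\<forall>x\<in>U \<inter> S. f x0 \<le> f x))"

end

(* A subgradient w of phi = f + delta_S at x near x0, where S is the feasible set, splits approximately
   as w = v + n with v a regular subgradient of f and n almost normal to S near x; this comes from
   minimizing f(y) - <w, y - x> + k |y - z|^2 / 2 + eta |z - x| over y and over z in S. By the horizon
   qualification all such v stay bounded, and as x tends to x0 and w to 0 they cluster at some v0 with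
   -v0 normal to S at x0, so f is variationally convex at x0 for v0 and v satisfies a convex subgradient
   inequality on a fixed neighbourhood. As S is convex near x0, adding the inequality for n gives the
   inequality for (x, w), and its validity for all (x, w) near (x0, 0) is variational convexity of phi.
   The positive linear independence condition enters only to identify the normals of S at x0. *)

theory Submission
  imports Defs
begin

section \<open>Lower semicontinuity and subgradients\<close>

text \<open>The splitting of \<open>w\<close> holds only up to errors and at base points other than
  \<open>x\<close>, but it is available at every point of the feasible set that carries a regular
  subgradient. The errors do no harm: they go to zero with \<open>x\<close> and \<open>w\<close>
  fixed, while the neighbourhood on which the subgradient inequality for \<open>f\<close> is valid
  stays the same. The obstacle is the uniformity of that neighbourhood, since each subgradient
  \<open>v0\<close> comes with its own and the relevant \<open>v0\<close> is known only after
  passing to a limit. Function values have to be carried along in every estimate, because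
  variational convexity controls the graph of the subdifferential only where \<open>f\<close> is
  below \<open>f x0 + \<epsilon>\<close>, and because limiting and horizon subgradients require
  convergence of the values, which is not implied by convergence of the points. Local minimality is
  the same inequality for the subgradient 0 at \<open>x0\<close>.\<close>

lemma lsc_fun_iff: "lsc_fun f \<longleftrightarrow> (\<forall>x. \<forall>c<f x. \<forall>\<^sub>F y in nhds x. c < f y)"
  unfolding lsc_fun_def le_Liminf_iff by blast

text \<open>The values may be infinite anywhere on \<open>K\<close>. Without a minimizer the open
  sets \<open>{x. f y < f x}\<close> with \<open>y \<in> K\<close> would cover \<open>K\<close>; but
  among finitely many such \<open>y\<close>, the one of lowest value is covered by none of the
  chosen sets.\<close>

lemma lsc_fun_attains_min:
  assumes "lsc_fun f" "compact K" "K \<noteq> {}"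
  shows "\<exists>x\<in>K. \<forall>y\<in>K. f x \<le> f y"
proof (rule ccontr)
  assume "\<not> ?thesis"
  then have nomin: "\<exists>y\<in>K. f y < f x" if "x \<in> K" for x
    using that by (auto simp: not_le)
  have op: "open {x. c < f x}" for c
  proof (rule Topological_Spaces.openI)
    fix x assume "x \<in> {x. c < f x}"
    then have "\<forall>\<^sub>F y in nhds x. c < f y"
      using assms(1) unfolding lsc_fun_iff by simp
    then show "\<exists>T. open T \<and> x \<in> T \<and> T \<subseteq> {x. c < f x}"
      unfolding eventually_nhds by blast
  qed
  have "K \<subseteq> (\<Union>y\<in>K. {x. f y < f x})"
    using nomin by blast
  then obtain D where D: "D \<subseteq> K" "finite D" "K \<subseteq> (\<Union>y\<in>D. {x. f y < f x})"
    by (rule compactE_image[OF assms(2) op])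
  have "D \<noteq> {}"
    using D(3) assms(3) by auto
  then have "Min (f ` D) \<in> f ` D"
    using D(2) by (intro Min_in) auto
  then obtain y where y: "y \<in> D" "f y = Min (f ` D)"
    by auto
  then have "f y \<le> f z" if "z \<in> D" for z
    using that D(2) by simp
  moreover obtain z where "z \<in> D" "f z < f y"
    using D y(1) by blast
  ultimately show False
    by (meson not_le)
qed

lemma lsc_fun_LIMSEQ_le:
  assumes "lsc_fun f" "X \<longlonglongrightarrow> x" "\<And>k. f (X k) \<le> c k" "c \<longlonglongrightarrow> C"
  shows "f x \<le> C"
proof (rule ccontr)
  assume "\<not> f x \<le> C"
  then obtain d where d: "C < d" "d < f x"
    using dense[of C "f x"] by (auto simp: not_le)
  have "\<forall>\<^sub>F y in nhds x. d < f y"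
    using assms(1) d(2) unfolding lsc_fun_iff by blast
  then have "\<forall>\<^sub>F k in sequentially. d < f (X k)"
    using assms(2) by (rule eventually_compose_filterlim)
  moreover have "\<forall>\<^sub>F k in sequentially. c k < d"
    using assms(4) d(1) by (rule order_tendstoD)
  ultimately have "\<forall>\<^sub>F k in sequentially. False"
  proof eventually_elim
    case (elim k)
    then show False using assms(3)[of k] by simp
  qed
  then show False by simp
qed

text \<open>Lower semicontinuity gives one half of the limit, the bounds \<open>c\<close> the other.
  This supplies the convergence of values that limiting and horizon subgradients demand.\<close>

lemma lsc_fun_LIMSEQ:
  assumes "lsc_fun f" "X \<longlonglongrightarrow> x" "\<And>k. f (X k) \<le> c k" "c \<longlonglongrightarrow> f x"
  shows "(\<lambda>k. f (X k)) \<longlonglongrightarrow> f x"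
proof (rule order_tendstoI)
  fix d assume "d < f x"
  then have "\<forall>\<^sub>F y in nhds x. d < f y"
    using assms(1) unfolding lsc_fun_iff by blast
  then show "\<forall>\<^sub>F k in sequentially. d < f (X k)"
    using assms(2) by (rule eventually_compose_filterlim)
next
  fix d assume "f x < d"
  then have "\<forall>\<^sub>F k in sequentially. c k < d"
    by (rule order_tendstoD(2)[OF assms(4)])
  then show "\<forall>\<^sub>F k in sequentially. f (X k) < d"
  proof eventually_elim
    case (elim k)
    then show ?case using assms(3)[of k] by simp
  qed
qed

lemma lsc_fun_compose:
  assumes "lsc_fun f" "continuous_on UNIV h"
  shows "lsc_fun (\<lambda>x. f (h x))"
  unfolding lsc_fun_iff
proof (intro allI impI)
  fix x c assume "c < f (h x)"
  then have "\<forall>\<^sub>F y in nhds (h x). c < f y"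
    using assms(1) unfolding lsc_fun_iff by blast
  moreover have "filterlim h (nhds (h x)) (nhds x)"
    using assms(2)
    by (simp add: continuous_on_def tendsto_at_iff_tendsto_nhds)
  ultimately show "\<forall>\<^sub>F y in nhds x. c < f (h y)"
    by (rule eventually_compose_filterlim)
qed

lemma lsc_fun_add_continuous:
  fixes f :: "'a::topological_space \<Rightarrow> ereal"
  assumes "lsc_fun f" "continuous_on UNIV h"
  shows "lsc_fun (\<lambda>x. f x + ereal (h x))"
  unfolding lsc_fun_iff
proof (intro allI impI)
  fix x c assume c: "c < f x + ereal (h x)"
  have h: "filterlim h (nhds (h x)) (nhds x)"
    using assms(2)
    by (simp add: continuous_on_def tendsto_at_iff_tendsto_nhds)
  \<comment> \<open>The bound \<open>c\<close> is split into strict bounds for the two summands. For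
    finite \<open>c\<close> a real \<open>s\<close> between \<open>c - h x\<close> and
    \<open>f x\<close> divides the slack; for \<open>c = -\<infinity>\<close> all that remains is
    \<open>f x > -\<infinity>\<close>, and any real below \<open>h x\<close> serves as
    \<open>b\<close>.\<close>
  have "\<exists>a b. c \<le> a + ereal b \<and> a < f x \<and> b < h x"
  proof (cases c)
    case (real r)
    with c have "ereal (r - h x) < f x"
      by (cases "f x") auto
    then obtain s where s: "ereal (r - h x) < ereal s" "ereal s < f x"
      using ereal_dense2 by blast
    then show ?thesis
      using real by (intro exI[of _ "ereal s"] exI[of _ "r - s"]) auto
  next
    case PInf
    with c show ?thesis by auto
  next
    case MInf
    with c have "-\<infinity> < f x" by (cases "f x") auto
    then obtain a where "a < f x" by blast
    then show ?thesis
      using MInf by (intro exI[of _ a] exI[of _ "h x - 1"]) auto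
  qed
  then obtain a b where ab: "c \<le> a + ereal b" "a < f x" "b < h x" by blast
  have "\<forall>\<^sub>F y in nhds x. a < f y"
    using assms(1) ab(2) unfolding lsc_fun_iff by blast
  moreover have "\<forall>\<^sub>F y in nhds x. b < h y"
    using h ab(3) by (rule order_tendstoD(1))
  ultimately show "\<forall>\<^sub>F y in nhds x. c < f y + ereal (h y)"
  proof eventually_elim
    case (elim y)
    then have "a + ereal b < f y + ereal (h y)"
      by (cases a; cases "f y") auto
    with ab(1) show ?case by (rule le_less_trans)
  qed
qed

section \<open>Regular subgradients as first-order inequalities\<close>

lemma mem_regular_subdiff_iff:
  "v \<in> regular_subdiff f x \<longleftrightarrow>
     \<bar>f x\<bar> \<noteq> \<infinity> \<and> (\<forall>e>0. \<forall>\<^sub>F y in nhds x. f x + ereal (v \<bullet> (y - x) - e * norm (y - x)) \<le> f y)"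
proof -
  have quot: "ereal (- e) < (f y - f x - ereal (v \<bullet> (y - x))) / ereal (norm (y - x)) \<longleftrightarrow>
      f x + ereal (v \<bullet> (y - x) - e * norm (y - x)) < f y"
    if "\<bar>f x\<bar> \<noteq> \<infinity>" "y \<noteq> x" for y e
  proof -
    have "norm (y - x) > 0" using that by simp
    then show ?thesis
      using that by (cases "f x"; cases "f y") (auto simp: pos_less_divide_eq algebra_simps)
  qed
  \<comment> \<open>At \<open>y = x\<close> the inequality is trivial, so punctured and full
    neighbourhoods are interchangeable.\<close>
  have nhds_at: "eventually P (nhds x) \<longleftrightarrow> eventually P (at x)" if "P x" for P
    using that by (auto simp: eventually_at_filter elim: eventually_mono)
  have "(\<forall>c<0. \<forall>\<^sub>F y in at x. c < (f y - f x - ereal (v \<bullet> (y - x))) / ereal (norm (y - x))) \<longleftrightarrow>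
     (\<forall>e>0. \<forall>\<^sub>F y in nhds x. f x + ereal (v \<bullet> (y - x) - e * norm (y - x)) \<le> f y)" (is "?L \<longleftrightarrow> ?R")
    if fin: "\<bar>f x\<bar> \<noteq> \<infinity>"
  proof
    assume L: ?L
    show ?R
    proof (intro allI impI)
      fix e :: real assume "e > 0"
      then have "\<forall>\<^sub>F y in at x. ereal (- e) < (f y - f x - ereal (v \<bullet> (y - x))) / ereal (norm (y - x))"
        using L by simp
      moreover have "\<forall>\<^sub>F y in at x. y \<noteq> x"
        by (simp add: eventually_at_filter)
      ultimately have "\<forall>\<^sub>F y in at x. f x + ereal (v \<bullet> (y - x) - e * norm (y - x)) \<le> f y"
        by eventually_elim (use quot[OF fin] in \<open>simp add: less_imp_le\<close>)
      then show "\<forall>\<^sub>F y in nhds x. f x + ereal (v \<bullet> (y - x) - e * norm (y - x)) \<le> f y"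
        by (subst nhds_at) (use fin in auto)
    qed
  next
    assume R: ?R
    show ?L
    proof (intro allI impI)
      fix c :: ereal assume "c < 0"
      then obtain r where r: "c < ereal r" "ereal r < 0"
        using ereal_dense2 by blast
      \<comment> \<open>The nonstrict inequality is then taken with \<open>e / 2\<close>; for
        \<open>y \<noteq> x\<close> this makes the one with \<open>e\<close> strict, as the liminf
        requires.\<close>
      define e where "e = - r"
      have e: "e > 0" "c < ereal (- e)"
        using r by (simp_all add: e_def)
      have "\<forall>\<^sub>F y in nhds x. f x + ereal (v \<bullet> (y - x) - e / 2 * norm (y - x)) \<le> f y"
        using R[rule_format, of "e / 2"] e by simp
      then have "\<forall>\<^sub>F y in at x. f x + ereal (v \<bullet> (y - x) - e / 2 * norm (y - x)) \<le> f y"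
        by (auto simp: eventually_at_filter elim: eventually_mono)
      moreover have "\<forall>\<^sub>F y in at x. y \<noteq> x"
        by (simp add: eventually_at_filter)
      ultimately show "\<forall>\<^sub>F y in at x. c < (f y - f x - ereal (v \<bullet> (y - x))) / ereal (norm (y - x))"
      proof eventually_elim
        case (elim y)
        have "f x + ereal (v \<bullet> (y - x) - e * norm (y - x)) <
          f x + ereal (v \<bullet> (y - x) - e / 2 * norm (y - x))"
          using fin e elim by (cases "f x") auto
        also note elim(1)
        finally have "ereal (- e) < (f y - f x - ereal (v \<bullet> (y - x))) / ereal (norm (y - x))"
          using quot[OF fin elim(2)] by simp
        with e(2) show ?case by (rule less_trans)
      qed
    qed
  qed
  then show ?thesis
    unfolding regular_subdiff_def le_Liminf_iff by auto
qed

lemma regular_subdiff_subset_limiting: "regular_subdiff f x \<subseteq> limiting_subdiff f x"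
proof
  fix v assume v: "v \<in> regular_subdiff f x"
  then have "\<bar>f x\<bar> \<noteq> \<infinity>" by (simp add: regular_subdiff_def)
  with v show "v \<in> limiting_subdiff f x"
    unfolding limiting_subdiff_def mem_Collect_eq
    by (intro conjI exI[of _ "\<lambda>_. x"] exI[of _ "\<lambda>_. v"]) auto
qed

lemma regular_subdiff_of_global:
  assumes "\<bar>f x\<bar> \<noteq> \<infinity>" "\<And>y. f x + ereal (v \<bullet> (y - x)) \<le> f y"
  shows "v \<in> regular_subdiff f x"
  unfolding mem_regular_subdiff_iff
proof (intro conjI allI impI always_eventually)
  fix e :: real and y assume "e > 0"
  then have "f x + ereal (v \<bullet> (y - x) - e * norm (y - x)) \<le> f x + ereal (v \<bullet> (y - x))"
    by (intro add_left_mono) simp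
  then show "f x + ereal (v \<bullet> (y - x) - e * norm (y - x)) \<le> f y"
    using assms(2) order_trans by blast
qed (use assms in auto)

text \<open>First-order optimality for \<open>f\<close> plus a smooth term: the remainder
  \<open>k / 2 * (norm (u - y))^2\<close> of the quadratic is below \<open>e * norm (u - y)\<close>
  as soon as \<open>u\<close> is close to \<open>y\<close>.\<close>

lemma regular_subdiff_of_prox_min:
  assumes fin: "\<bar>f y\<bar> \<noteq> \<infinity>" and "k \<ge> 0"
    and min: "\<forall>\<^sub>F u in nhds y. f y + ereal (k / 2 * (norm (y - z))\<^sup>2 - w \<bullet> y) \<le>
        f u + ereal (k / 2 * (norm (u - z))\<^sup>2 - w \<bullet> u)"
  shows "w - k *\<^sub>R (y - z) \<in> regular_subdiff f y"
  unfolding mem_regular_subdiff_iff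
proof (intro conjI allI impI)
  \<comment> \<open>The radius \<open>e / (k + 1)\<close> yields
    \<open>k / 2 * norm (u - y) \<le> e\<close>; the added 1 covers \<open>k = 0\<close>.\<close>
  fix e :: real assume e: "e > 0"
  have "\<forall>\<^sub>F u in nhds y. dist u y < e / (k + 1)"
    unfolding eventually_nhds_metric using e \<open>k \<ge> 0\<close>
    by (intro exI[of _ "e / (k + 1)"]) simp
  with min show "\<forall>\<^sub>F u in nhds y.
      f y + ereal ((w - k *\<^sub>R (y - z)) \<bullet> (u - y) - e * norm (u - y)) \<le> f u"
  proof eventually_elim
    case (elim u)
    have "(k + 1) * norm (u - y) < e"
      using elim(2) \<open>k \<ge> 0\<close> by (simp add: dist_norm pos_less_divide_eq mult.commute)
    then have "k / 2 * norm (u - y) \<le> e"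
      using \<open>k \<ge> 0\<close> by (smt (verit) mult_nonneg_nonneg mult_right_mono norm_ge_zero field_sum_of_halves)
    then have "k / 2 * norm (u - y) * norm (u - y) \<le> e * norm (u - y)"
      by (intro mult_right_mono) auto
    moreover have "k / 2 * (norm (u - z))\<^sup>2 =
        k / 2 * (norm (y - z))\<^sup>2 + k * ((y - z) \<bullet> (u - y)) + k / 2 * norm (u - y) * norm (u - y)"
    proof -
      have "(norm (u - z))\<^sup>2 = (norm (y - z))\<^sup>2 + 2 * ((y - z) \<bullet> (u - y)) + norm (u - y) * norm (u - y)"
        by (simp add: power2_norm_eq_inner inner_commute algebra_simps flip: power2_eq_square)
      then show ?thesis by (simp only:) (simp add: algebra_simps)
    qed
    moreover have "(w - k *\<^sub>R (y - z)) \<bullet> (u - y) = w \<bullet> u - w \<bullet> y - k * ((y - z) \<bullet> (u - y))"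
      by (simp add: inner_diff_left inner_diff_right[of w])
    ultimately have "w \<bullet> u - w \<bullet> y + k / 2 * (norm (y - z))\<^sup>2 - k / 2 * (norm (u - z))\<^sup>2
       \<ge> (w - k *\<^sub>R (y - z)) \<bullet> (u - y) - e * norm (u - y)"
      by linarith
    moreover have "f y + ereal (w \<bullet> u - w \<bullet> y + k / 2 * (norm (y - z))\<^sup>2 - k / 2 * (norm (u - z))\<^sup>2) \<le> f u"
      using elim(1) fin by (cases "f y"; cases "f u") (auto simp: algebra_simps)
    ultimately show ?case
      by (cases "f y"; cases "f u") auto
  qed
qed (use fin in auto)

text \<open>If the inequality failed at \<open>y\<close>, convexity of the epigraph would spread the
  deficit along the segment from \<open>x\<close> to \<open>y\<close> in proportion to the distance
  from \<open>x\<close>, whereas a regular subgradient tolerates only an arbitrarily small slope. As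
  \<open>h y\<close> may be \<open>-\<infinity>\<close>, a real \<open>t\<close> above it takes its
  place.\<close>

lemma convex_regular_subgradient:
  assumes "convex_fun h" "v \<in> regular_subdiff h x"
  shows "h x + ereal (v \<bullet> (y - x)) \<le> h y"
proof (rule ccontr)
  obtain a where a: "h x = ereal a"
    using assms(2) by (auto simp: regular_subdiff_def)
  assume "\<not> h x + ereal (v \<bullet> (y - x)) \<le> h y"
  then obtain t where t: "h y < ereal t" "t < a + v \<bullet> (y - x)"
    using a ereal_dense2 by (metis not_le plus_ereal.simps(1) less_ereal.simps(1))
  \<comment> \<open>Chosen so that \<open>e * norm (y - x)\<close> stays below the deficit by
    exactly \<open>e\<close>; the added 1 keeps the denominator positive for
    \<open>y = x\<close>.\<close>
  define e where "e = (a + v \<bullet> (y - x) - t) / (norm (y - x) + 1)"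
  have np: "norm (y - x) + 1 > 0"
    by (simp add: add_nonneg_pos)
  have e: "e > 0" using t np by (simp add: e_def)
  have en: "e * norm (y - x) + e = a + v \<bullet> (y - x) - t"
  proof -
    have "e * (norm (y - x) + 1) = a + v \<bullet> (y - x) - t"
      using np by (simp add: e_def)
    then show ?thesis by (simp add: distrib_left)
  qed
  have "\<forall>\<^sub>F z in nhds x. h x + ereal (v \<bullet> (z - x) - e * norm (z - x)) \<le> h z"
    using assms(2) e unfolding mem_regular_subdiff_iff by blast
  moreover have "((\<lambda>s. x + s *\<^sub>R (y - x)) \<longlongrightarrow> x) (at_right (0::real))"
    by (auto intro!: tendsto_eq_intros)
  ultimately have "\<forall>\<^sub>F s in at_right (0::real).
      h x + ereal (v \<bullet> (x + s *\<^sub>R (y - x) - x) - e * norm (x + s *\<^sub>R (y - x) - x)) \<le> h (x + s *\<^sub>R (y - x))"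
    by (rule eventually_compose_filterlim)
  moreover have "\<forall>\<^sub>F s in at_right (0::real). s \<in> {0<..<1}"
    by (intro eventually_at_right_real) simp
  ultimately have "\<forall>\<^sub>F s in at_right (0::real). False"
  proof eventually_elim
    case (elim s)
    have "(1 - s) *\<^sub>R (x, a) + s *\<^sub>R (y, t) \<in> {(x, t). h x \<le> ereal t}"
      using assms(1) elim(2) a t unfolding convex_fun_def convex_alt by auto
    then have "h (x + s *\<^sub>R (y - x)) \<le> ereal ((1 - s) * a + s * t)"
      by (simp add: algebra_simps)
    with elim a have "a + s * (v \<bullet> (y - x)) - e * (s * norm (y - x)) \<le> (1 - s) * a + s * t"
      by (auto simp: dest: order_trans)
    then have "s * (a + v \<bullet> (y - x) - t - e * norm (y - x)) \<le> 0"
      by (simp add: algebra_simps)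
    then have "a + v \<bullet> (y - x) - t - e * norm (y - x) \<le> 0"
      using elim(2) by (simp add: mult_le_0_iff)
    with en e show False by simp
  qed
  then show False by simp
qed

lemma limiting_subdiffE:
  assumes "v \<in> limiting_subdiff f x"
  obtains X V where "\<bar>f x\<bar> \<noteq> \<infinity>" "\<And>k. V k \<in> regular_subdiff f (X k)" "X \<longlonglongrightarrow> x"
    "(\<lambda>k. f (X k)) \<longlonglongrightarrow> f x" "V \<longlonglongrightarrow> v"
  using assms unfolding limiting_subdiff_def mem_Collect_eq
  by (elim conjE exE) (rule that, auto)

lemma subgradient_ineq_limit:
  fixes f :: "'a::euclidean_space \<Rightarrow> ereal"
  assumes "\<bar>f x\<bar> \<noteq> \<infinity>" "X \<longlonglongrightarrow> x" "(\<lambda>k. f (X k)) \<longlonglongrightarrow> f x" "V \<longlonglongrightarrow> v"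
    and "\<forall>\<^sub>F k in sequentially. f (X k) + ereal (V k \<bullet> (y - X k)) \<le> f y"
  shows "f x + ereal (v \<bullet> (y - x)) \<le> f y"
proof (rule tendsto_upperbound[OF _ assms(5)])
  show "(\<lambda>k. f (X k) + ereal (V k \<bullet> (y - X k))) \<longlonglongrightarrow> f x + ereal (v \<bullet> (y - x))"
    using assms(1-4) by (intro tendsto_add_ereal_general tendsto_ereal tendsto_intros) auto
qed simp

lemma convex_limiting_subgradient:
  assumes "convex_fun h" "v \<in> limiting_subdiff h x"
  shows "h x + ereal (v \<bullet> (y - x)) \<le> h y"
  using assms(2)
proof (rule limiting_subdiffE)
  fix X V
  assume "\<bar>h x\<bar> \<noteq> \<infinity>" "\<And>k. V k \<in> regular_subdiff h (X k)" "X \<longlonglongrightarrow> x"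
    "(\<lambda>k. h (X k)) \<longlonglongrightarrow> h x" "V \<longlonglongrightarrow> v"
  then show ?thesis
    using convex_regular_subgradient[OF assms(1)] by (intro subgradient_ineq_limit) auto
qed

section \<open>Decoupling a sum with an indicator\<close>

text \<open>A growing penalty \<open>k\<close> on the distance of \<open>y\<close> and
  \<open>z\<close> decouples the function from the set. The term with \<open>\<eta>\<close> makes
  \<open>x\<close> the only limit of the minimizers and reappears as the error in the last
  conclusion. No bound on \<open>k\<close> or on the normal \<open>k *\<^sub>R (y - z)\<close> is
  claimed; boundedness comes later, from the horizon condition.\<close>

lemma regular_subdiff_indicator_fuzzy:
  fixes f :: "'a::euclidean_space \<Rightarrow> ereal"
  assumes "lsc_fun f" and f_minf: "\<And>x. f x \<noteq> -\<infinity>" and "closed S" and conv: "convex (S \<inter> W)"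
    and "open W" "x \<in> W"
    and w: "w \<in> regular_subdiff (\<lambda>x. f x + indicator_inf S x) x" and "\<eta> > 0" "\<gamma> > 0"
  obtains y z k where "k \<ge> 0" "norm (y - x) < \<gamma>" "norm (z - x) < \<gamma>" "z \<in> S"
    "f x - ereal \<gamma> < f y" "f y < f x + ereal \<gamma>" "w - k *\<^sub>R (y - z) \<in> regular_subdiff f y"
    "\<forall>z'\<in>S \<inter> W. (k *\<^sub>R (y - z)) \<bullet> (z' - z) \<le> \<eta> * norm (z' - z)"
proof -
  have xS: "x \<in> S" and "\<bar>f x\<bar> \<noteq> \<infinity>"
    using w f_minf[of x] unfolding regular_subdiff_def indicator_inf_def by (auto split: if_splits)
  then obtain a where a: "f x = ereal a" by auto
  have "\<forall>\<^sub>F z in nhds x. f x - ereal \<gamma> < f z"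
    using assms(1) \<open>\<gamma> > 0\<close> a unfolding lsc_fun_iff by simp
  moreover have "\<forall>\<^sub>F z in nhds x. f x + indicator_inf S x + ereal (w \<bullet> (z - x) - \<eta> / 2 * norm (z - x))
      \<le> f z + indicator_inf S z"
    using w \<open>\<eta> > 0\<close> unfolding mem_regular_subdiff_iff by (meson half_gt_zero)
  moreover have "\<forall>\<^sub>F z in nhds x. z \<in> W"
    using \<open>open W\<close> \<open>x \<in> W\<close> by (rule eventually_nhds_in_open)
  ultimately have "\<forall>\<^sub>F z in nhds x. f x - ereal \<gamma> < f z \<and> z \<in> W \<and>
      (z \<in> S \<longrightarrow> f x + ereal (w \<bullet> (z - x) - \<eta> / 2 * norm (z - x)) \<le> f z)"
    by eventually_elim (use xS in \<open>auto simp: indicator_inf_def\<close>)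
  then obtain r0 where r0: "r0 > 0" "\<And>z. dist z x < r0 \<Longrightarrow> f x - ereal \<gamma> < f z \<and> z \<in> W \<and>
      (z \<in> S \<longrightarrow> f x + ereal (w \<bullet> (z - x) - \<eta> / 2 * norm (z - x)) \<le> f z)"
    unfolding eventually_nhds_metric by blast
  define r where "r = min (r0 / 2) (\<gamma> / 2)"
  have r: "r > 0" "r < r0" "r < \<gamma>"
    using r0(1) \<open>\<gamma> > 0\<close> by (auto simp: r_def)
  have near: "f x - ereal \<gamma> < f z" "z \<in> W"
      "z \<in> S \<Longrightarrow> f x + ereal (w \<bullet> (z - x) - \<eta> / 2 * norm (z - x)) \<le> f z"
    if "norm (z - x) \<le> r" for z
    using r0(2)[of z] that r by (auto simp: dist_norm)
  define K where "K = cball x r \<times> (S \<inter> cball x r)"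
  have K: "compact K" "(x, x) \<in> K"
    using \<open>closed S\<close> xS r(1) by (auto simp: K_def intro!: compact_Times closed_Int_compact)
  \<comment> \<open>The objective without \<open>f\<close>, for penalty \<open>c\<close>. With
    \<open>w \<bullet> (y - x)\<close> instead of \<open>w \<bullet> y\<close> it vanishes at
    \<open>(x, x)\<close>, the point of comparison.\<close>
  define h where "h c y z = c / 2 * (norm (y - z))\<^sup>2 - w \<bullet> (y - x) + \<eta> * norm (z - x)"
    for c :: real and y z
  have "\<exists>p\<in>K. \<forall>q\<in>K. f (fst p) + ereal (h c (fst p) (snd p)) \<le> f (fst q) + ereal (h c (fst q) (snd q))" for c
  proof (rule lsc_fun_attains_min)
    show "lsc_fun (\<lambda>p. f (fst p) + ereal (h c (fst p) (snd p)))"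
      unfolding h_def
      by (intro lsc_fun_add_continuous lsc_fun_compose[OF assms(1)] continuous_intros)
  qed (use K in auto)
  then have "\<forall>n::nat. \<exists>p. p \<in> K \<and>
      (\<forall>q\<in>K. f (fst p) + ereal (h (real (Suc n)) (fst p) (snd p)) \<le> f (fst q) + ereal (h (real (Suc n)) (fst q) (snd q)))"
    by blast
  then obtain P where P: "\<And>n. P n \<in> K"
      "\<And>n q. q \<in> K \<Longrightarrow> f (fst (P n)) + ereal (h (real (Suc n)) (fst (P n)) (snd (P n)))
         \<le> f (fst q) + ereal (h (real (Suc n)) (fst q) (snd q))"
    by metis
  have Pr: "norm (fst (P n) - x) \<le> r" "norm (snd (P n) - x) \<le> r" "snd (P n) \<in> S" for n
    using P(1)[of n] by (auto simp: K_def mem_Times_iff dist_norm norm_minus_commute)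
  have Px: "f (fst (P n)) + ereal (h (real (Suc n)) (fst (P n)) (snd (P n))) \<le> ereal a" for n
    using P(2)[OF K(2), of n] by (simp add: h_def a)
  \<comment> \<open>On the ball, \<open>f\<close> exceeds \<open>a - \<gamma>\<close> and the linear
    term is at most \<open>norm w * r\<close>, so comparison with \<open>(x, x)\<close> leaves at
    most \<open>M / 2\<close> for the penalty.\<close>
  define M where "M = 2 * (\<gamma> + norm w * r)"
  have bound: "f (fst (P n)) \<le> ereal (a + w \<bullet> (fst (P n) - x) - \<eta> * norm (snd (P n) - x))"
      "(norm (fst (P n) - snd (P n)))\<^sup>2 \<le> M * inverse (real (Suc n))" for n
  proof -
    have "f (fst (P n)) \<noteq> \<infinity>" using Px[of n] by auto
    then obtain b where b: "f (fst (P n)) = ereal b"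
      using f_minf[of "fst (P n)"] by (cases "f (fst (P n))") auto
    have 1: "b + real (Suc n) / 2 * (norm (fst (P n) - snd (P n)))\<^sup>2 - w \<bullet> (fst (P n) - x)
        + \<eta> * norm (snd (P n) - x) \<le> a"
      using Px[of n] b by (simp add: h_def)
    moreover have "real (Suc n) / 2 * (norm (fst (P n) - snd (P n)))\<^sup>2 \<ge> 0" by simp
    ultimately have "b \<le> a + w \<bullet> (fst (P n) - x) - \<eta> * norm (snd (P n) - x)" by linarith
    then show "f (fst (P n)) \<le> ereal (a + w \<bullet> (fst (P n) - x) - \<eta> * norm (snd (P n) - x))"
      using b by simp
    have "w \<bullet> (fst (P n) - x) \<le> norm w * r"
      using norm_cauchy_schwarz[of w "fst (P n) - x"] Pr(1)[of n]
      by (meson mult_left_mono norm_ge_zero order_trans)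
    moreover have "b > a - \<gamma>"
      using near(1)[OF Pr(1), of n] a b by simp
    moreover have "\<eta> * norm (snd (P n) - x) \<ge> 0" using \<open>\<eta> > 0\<close> by simp
    ultimately have "real (Suc n) / 2 * (norm (fst (P n) - snd (P n)))\<^sup>2 \<le> \<gamma> + norm w * r"
      using 1 by linarith
    then have "(norm (fst (P n) - snd (P n)))\<^sup>2 * real (Suc n) \<le> M"
      by (simp add: M_def algebra_simps)
    then show "(norm (fst (P n) - snd (P n)))\<^sup>2 \<le> M * inverse (real (Suc n))"
      by (simp add: pos_le_divide_eq flip: divide_inverse)
  qed
  obtain l s where l: "l \<in> K" "strict_mono (s :: nat \<Rightarrow> nat)" "(P \<circ> s) \<longlonglongrightarrow> l"
    using K(1) P(1) unfolding compact_def by metis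
  define y z where "y = fst l" and "z = snd l"
  have lim: "(\<lambda>j. fst (P (s j))) \<longlonglongrightarrow> y" "(\<lambda>j. snd (P (s j))) \<longlonglongrightarrow> z"
    using tendsto_fst[OF l(3)] tendsto_snd[OF l(3)] by (simp_all add: y_def z_def o_def)
  have "(norm (y - z))\<^sup>2 \<le> M * 0"
  proof (rule LIMSEQ_le)
    show "(\<lambda>j. (norm (fst (P (s j)) - snd (P (s j))))\<^sup>2) \<longlonglongrightarrow> (norm (y - z))\<^sup>2"
      by (intro tendsto_intros lim)
    show "(\<lambda>j. M * inverse (real (Suc (s j)))) \<longlonglongrightarrow> M * 0"
      using LIMSEQ_subseq_LIMSEQ[OF LIMSEQ_inverse_real_of_nat l(2)]
      by (intro tendsto_mult_left) (simp add: o_def)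
  qed (use bound(2) in blast)
  then have yz: "z = y" by simp
  have "f y \<le> ereal (a + w \<bullet> (y - x) - \<eta> * norm (y - x))"
  proof (rule lsc_fun_LIMSEQ_le[OF assms(1) lim(1) bound(1)])
    show "(\<lambda>j. ereal (a + w \<bullet> (fst (P (s j)) - x) - \<eta> * norm (snd (P (s j)) - x)))
        \<longlonglongrightarrow> ereal (a + w \<bullet> (y - x) - \<eta> * norm (y - x))"
      by (intro tendsto_intros lim(1) lim(2)[unfolded yz])
  qed
  \<comment> \<open>The subgradient inequality with slope \<open>\<eta> / 2\<close> meets the
    minimality bound with slope \<open>\<eta>\<close>; both can hold only at
    \<open>y = x\<close>.\<close>
  moreover have "f x + ereal (w \<bullet> (y - x) - \<eta> / 2 * norm (y - x)) \<le> f y"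
    using l(1) yz by (intro near(3)) (auto simp: K_def y_def z_def mem_Times_iff dist_norm norm_minus_commute)
  ultimately have "ereal (a + (w \<bullet> (y - x) - \<eta> / 2 * norm (y - x))) \<le> ereal (a + w \<bullet> (y - x) - \<eta> * norm (y - x))"
    using a by (metis order_trans plus_ereal.simps(1))
  then have "\<eta> * norm (y - x) \<le> 0" by simp
  then have "y = x" using \<open>\<eta> > 0\<close> by (simp add: mult_le_0_iff)
  with yz have "z = x" by simp
  \<comment> \<open>Far along the subsequence the minimizers are interior to the balls, so the
    restriction to the balls drops out of the optimality conditions.\<close>
  have "(\<lambda>j. norm (fst (P (s j)) - x)) \<longlonglongrightarrow> norm (x - x)"
    using lim(1) unfolding \<open>y = x\<close> by (intro tendsto_intros)
  then have "\<forall>\<^sub>F j in sequentially. norm (fst (P (s j)) - x) < r"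
    by (rule order_tendstoD) (use r in simp)
  moreover have "(\<lambda>j. norm (snd (P (s j)) - x)) \<longlonglongrightarrow> norm (x - x)"
    using lim(2) unfolding \<open>z = x\<close> by (intro tendsto_intros)
  then have "\<forall>\<^sub>F j in sequentially. norm (snd (P (s j)) - x) < r"
    by (rule order_tendstoD) (use r in simp)
  moreover have "(\<lambda>j. w \<bullet> (fst (P (s j)) - x)) \<longlonglongrightarrow> w \<bullet> (x - x)"
    using lim(1) unfolding \<open>y = x\<close> by (intro tendsto_intros)
  then have "\<forall>\<^sub>F j in sequentially. w \<bullet> (fst (P (s j)) - x) < \<gamma>"
    by (rule order_tendstoD) (use \<open>\<gamma> > 0\<close> in simp)
  ultimately have "\<forall>\<^sub>F j in sequentially. norm (fst (P (s j)) - x) < r \<and> norm (snd (P (s j)) - x) < r \<and>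
      w \<bullet> (fst (P (s j)) - x) < \<gamma>"
    by eventually_elim blast
  from eventually_happens'[OF sequentially_bot this] obtain j where j: "norm (fst (P (s j)) - x) < r" "norm (snd (P (s j)) - x) < r"
      "w \<bullet> (fst (P (s j)) - x) < \<gamma>"
    by blast
  define k u v where "k = real (Suc (s j))" and "u = fst (P (s j))" and "v = snd (P (s j))"
  have k: "k \<ge> 0" by (simp add: k_def)
  have uv: "norm (u - x) < r" "norm (v - x) < r" "w \<bullet> (u - x) < \<gamma>" "v \<in> S"
    using j Pr(3) by (simp_all add: u_def v_def)
  have fu: "f u \<le> ereal (a + w \<bullet> (u - x) - \<eta> * norm (v - x))"
    using bound(1) by (simp add: u_def v_def)
  then obtain b where b: "f u = ereal b"
    using f_minf[of u] by (cases "f u") auto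
  have min: "f u + ereal (h k u v) \<le> f u' + ereal (h k u' v')"
    if "norm (u' - x) \<le> r" "norm (v' - x) \<le> r" "v' \<in> S" for u' v'
    using P(2)[of "(u', v')" "s j"] that
    by (simp add: K_def k_def u_def v_def dist_norm norm_minus_commute)
  show thesis
  proof (rule that[of k u v])
    have "b \<le> a + w \<bullet> (u - x) - \<eta> * norm (v - x)" using fu b by simp
    moreover have "\<eta> * norm (v - x) \<ge> 0" using \<open>\<eta> > 0\<close> by simp
    ultimately show "f u < f x + ereal \<gamma>" using uv(3) a b by simp
    show "f x - ereal \<gamma> < f u" using near(1) uv(1) by simp
    show "w - k *\<^sub>R (u - v) \<in> regular_subdiff f u"
    proof (rule regular_subdiff_of_prox_min)
      have "\<forall>\<^sub>F u' in nhds u. u' \<in> ball x r"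
        using uv(1) by (intro eventually_nhds_in_open) (auto simp: dist_norm norm_minus_commute)
      then show "\<forall>\<^sub>F u' in nhds u. f u + ereal (k / 2 * (norm (u - v))\<^sup>2 - w \<bullet> u) \<le>
          f u' + ereal (k / 2 * (norm (u' - v))\<^sup>2 - w \<bullet> u')"
      proof eventually_elim
        case (elim u')
        then have "f u + ereal (h k u v) \<le> f u' + ereal (h k u' v)"
          using uv by (intro min) (auto simp: dist_norm norm_minus_commute)
        then show ?case
          using b f_minf[of u'] by (cases "f u'") (auto simp: h_def inner_diff_right)
      qed
    qed (use b k in auto)
    have "(k *\<^sub>R (u - v)) \<bullet> (z' - v) \<le> \<eta> * norm (z' - v)" if z': "z' \<in> S \<inter> W" for z'
    proof (rule tendsto_lowerbound)
      \<comment> \<open>Minimality in the second variable is tested at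
        \<open>v + t *\<^sub>R d\<close>, which stays in \<open>S\<close> by convexity of
        \<open>S \<inter> W\<close>. Dividing by \<open>t\<close> and letting \<open>t\<close> tend
        to 0 removes the quadratic remainder.\<close>
      define d where "d = z' - v"
      show "((\<lambda>t. k / 2 * t * (norm d)\<^sup>2 + \<eta> * norm d) \<longlongrightarrow> \<eta> * norm (z' - v)) (at_right 0)"
        by (auto intro!: tendsto_eq_intros simp: d_def)
      have "((\<lambda>t. norm (v + t *\<^sub>R d - x)) \<longlongrightarrow> norm (v - x)) (at_right 0)"
        by (auto intro!: tendsto_eq_intros)
      then have "\<forall>\<^sub>F t in at_right 0. norm (v + t *\<^sub>R d - x) < r"
        by (rule order_tendstoD) (use uv in simp)
      moreover have "\<forall>\<^sub>F t in at_right (0::real). t \<in> {0<..<1}"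
        by (intro eventually_at_right_real) simp
      ultimately show "\<forall>\<^sub>F t in at_right 0. (k *\<^sub>R (u - v)) \<bullet> (z' - v) \<le> k / 2 * t * (norm d)\<^sup>2 + \<eta> * norm d"
      proof eventually_elim
        case (elim t)
        have "v \<in> S \<inter> W" using uv near(2)[of v] by simp
        with conv z' elim(2) have "(1 - t) *\<^sub>R v + t *\<^sub>R z' \<in> S \<inter> W"
          unfolding convex_alt by auto
        then have "v + t *\<^sub>R d \<in> S" by (simp add: d_def algebra_simps)
        then have "f u + ereal (h k u v) \<le> f u + ereal (h k u (v + t *\<^sub>R d))"
          using uv elim(1) by (intro min) auto
        then have "k / 2 * (norm (u - v))\<^sup>2 + \<eta> * norm (v - x) \<le>
            k / 2 * (norm (u - (v + t *\<^sub>R d)))\<^sup>2 + \<eta> * norm (v + t *\<^sub>R d - x)"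
          using b by (simp add: h_def)
        moreover have "norm (v + t *\<^sub>R d - x) \<le> norm (v - x) + t * norm d"
          using norm_triangle_ineq[of "v - x" "t *\<^sub>R d"] elim(2) by (simp add: algebra_simps)
        then have "\<eta> * norm (v + t *\<^sub>R d - x) \<le> \<eta> * (norm (v - x) + t * norm d)"
          using \<open>\<eta> > 0\<close> by (intro mult_left_mono) auto
        moreover have "k / 2 * (norm (u - (v + t *\<^sub>R d)))\<^sup>2 =
            k / 2 * (norm (u - v))\<^sup>2 - t * (k * ((u - v) \<bullet> d)) + t * (k / 2 * t * (norm d)\<^sup>2)"
        proof -
          have "(norm (u - (v + t *\<^sub>R d)))\<^sup>2 = (norm (u - v))\<^sup>2 - 2 * t * ((u - v) \<bullet> d) + t\<^sup>2 * (norm d)\<^sup>2"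
            unfolding power2_norm_eq_inner by (simp add: inner_commute power2_eq_square algebra_simps)
          then show ?thesis by (simp only:) (simp add: algebra_simps power2_eq_square)
        qed
        ultimately have "t * (k * ((u - v) \<bullet> d)) \<le> t * (k / 2 * t * (norm d)\<^sup>2 + \<eta> * norm d)"
          by (simp add: algebra_simps)
        then show ?case using elim(2) by (simp add: d_def)
      qed
    qed simp
    then show "\<forall>z'\<in>S \<inter> W. (k *\<^sub>R (u - v)) \<bullet> (z' - v) \<le> \<eta> * norm (z' - v)"
      by blast
  qed (use uv r k in auto)
qed

text \<open>The convex minorant satisfies the inequality everywhere, agrees with \<open>f\<close> at
  \<open>y\<close> and lies below \<open>f\<close> at \<open>y'\<close>. Variational convexity of
  \<open>f\<close> enters the proof only in this form.\<close>

lemma variationally_convex_subgradient: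
  assumes "variationally_convex f x0 v0"
  obtains U V \<epsilon> where "open U" "x0 \<in> U" "open V" "v0 \<in> V" "\<epsilon> > 0"
    "\<And>y v y'. \<lbrakk>y \<in> U; v \<in> V; f y < f x0 + ereal \<epsilon>; v \<in> limiting_subdiff f y; y' \<in> U\<rbrakk> \<Longrightarrow>
       f y + ereal (v \<bullet> (y' - y)) \<le> f y'"
proof -
  obtain U V h \<epsilon> where *: "open U" "x0 \<in> U" "open V" "v0 \<in> V" "convex_fun h"
    "\<forall>x\<in>U. h x \<le> f x" "(\<epsilon>::real) > 0"
    and gph: "({x \<in> U. f x < f x0 + ereal \<epsilon>} \<times> V) \<inter> gph_subdiff f = (U \<times> V) \<inter> gph_subdiff h"
      "\<forall>(x, v) \<in> (U \<times> V) \<inter> gph_subdiff h. f x = h x"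
    using assms unfolding variationally_convex_def by (elim conjE exE) (rule that)
  show thesis
  proof (rule that[OF *(1-4,7)])
    fix y v y'
    assume "y \<in> U" "v \<in> V" "f y < f x0 + ereal \<epsilon>" "v \<in> limiting_subdiff f y" "y' \<in> U"
    then have yv: "(y, v) \<in> (U \<times> V) \<inter> gph_subdiff h"
      unfolding gph(1)[symmetric] by (simp add: gph_subdiff_def)
    then have "f y = h y" using gph(2) by blast
    also have "h y + ereal (v \<bullet> (y' - y)) \<le> h y'"
      using convex_limiting_subgradient[OF *(5)] yv by (simp add: gph_subdiff_def)
    also have "h y' \<le> f y'" using *(6) \<open>y' \<in> U\<close> by blast
    finally show "f y + ereal (v \<bullet> (y' - y)) \<le> f y'" .
  qed
qed

section \<open>Variational convexity of the constrained objective\<close>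

text \<open>In the application \<open>T\<close> is the feasible set near \<open>x0\<close> and
  \<open>N\<close> the normal image. A common \<open>\<delta>\<close> is found by contradiction:
  counterexamples for \<open>\<delta>\<close> tending to 0 accumulate at a single subgradient of
  \<open>f\<close> at \<open>x0\<close>, and late ones lie in the neighbourhood that this
  subgradient provides.\<close>

lemma uniform_subgradient_inequality:
  fixes f :: "'a::euclidean_space \<Rightarrow> ereal"
  assumes "lsc_fun f" and fin: "\<bar>f x0\<bar> \<noteq> \<infinity>"
    and vc: "\<And>v. v \<in> limiting_subdiff f x0 \<Longrightarrow> - v \<in> N \<Longrightarrow> variationally_convex f x0 v"
    and hor: "horizon_subdiff f x0 \<inter> uminus ` N \<subseteq> {0}"
    and normal: "\<And>\<nu>. (\<And>z. z \<in> T \<Longrightarrow> \<nu> \<bullet> (z - x0) \<le> 0) \<Longrightarrow> \<nu> \<in> N"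
  shows "\<exists>\<delta>>0. \<forall>y v z n \<eta> y'. v \<in> regular_subdiff f y \<and> norm (y - x0) < \<delta> \<and>
     f y < f x0 + ereal \<delta> \<and> norm (z - x0) < \<delta> \<and> 0 \<le> \<eta> \<and> \<eta> < \<delta> \<and>
     (\<forall>z'\<in>T. n \<bullet> (z' - z) \<le> \<eta> * norm (z' - z)) \<and> norm (v + n) < \<delta> \<and> norm (y' - x0) < \<delta> \<longrightarrow>
     f y + ereal (v \<bullet> (y' - y)) \<le> f y'"
proof -
  define P where "P \<delta> y v z n \<eta> y' \<longleftrightarrow>
       v \<in> regular_subdiff f y \<and> norm (y - x0) < \<delta> \<and> f y < f x0 + ereal \<delta> \<and>
       norm (z - x0) < \<delta> \<and> 0 \<le> \<eta> \<and> \<eta> < \<delta> \<and> (\<forall>z'\<in>T. n \<bullet> (z' - z) \<le> \<eta> * norm (z' - z)) \<and>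
       norm (v + n) < \<delta> \<and> norm (y' - x0) < \<delta> \<and> \<not> f y + ereal (v \<bullet> (y' - y)) \<le> f y'"
    for \<delta> y v z n \<eta> y'
  have "\<exists>\<delta>>0. \<forall>y v z n \<eta> y'. \<not> P \<delta> y v z n \<eta> y'"
  proof (rule ccontr)
    define r where "r = (\<lambda>j. inverse (real (Suc j)))"
    have r: "r \<longlonglongrightarrow> 0" "\<And>j. r j > 0"
      unfolding r_def by (rule LIMSEQ_inverse_real_of_nat) simp
    assume "\<not> (\<exists>\<delta>>0. \<forall>y v z n \<eta> y'. \<not> P \<delta> y v z n \<eta> y')"
    then have "\<forall>j. \<exists>y v z n \<eta> y'. P (r j) y v z n \<eta> y'"
      using r(2) by blast
    then obtain Y V Z n E Y' where "\<And>j. P (r j) (Y j) (V j) (Z j) (n j) (E j) (Y' j)"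
      by metis
    then have Y: "\<And>j. V j \<in> regular_subdiff f (Y j)" "\<And>j. norm (Y j - x0) < r j"
        "\<And>j. f (Y j) < f x0 + ereal (r j)"
      and Z: "\<And>j. norm (Z j - x0) < r j"
      and E: "\<And>j. 0 \<le> E j" "\<And>j. E j < r j"
      and n: "\<And>j z'. z' \<in> T \<Longrightarrow> n j \<bullet> (z' - Z j) \<le> E j * norm (z' - Z j)"
      and Vn: "\<And>j. norm (V j + n j) < r j"
      and Y': "\<And>j. norm (Y' j - x0) < r j" "\<And>j. \<not> f (Y j) + ereal (V j \<bullet> (Y' j - Y j)) \<le> f (Y' j)"
      unfolding P_def by blast+
    have small: "X \<longlonglongrightarrow> L" if "\<And>j. norm (X j - L) < r j" for X and L :: "'b::real_normed_vector"
      by (rule LIM_zero_cancel, rule Lim_null_comparison[OF always_eventually r(1)])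
        (use that less_imp_le in blast)
    have lim: "Y \<longlonglongrightarrow> x0" "Z \<longlonglongrightarrow> x0" "Y' \<longlonglongrightarrow> x0" "E \<longlonglongrightarrow> 0" "(\<lambda>j. V j + n j) \<longlonglongrightarrow> 0"
      using Y(2) Z Y'(1) E Vn by (auto intro!: small)
    have "(\<lambda>j. f x0 + ereal (r j)) \<longlonglongrightarrow> f x0 + ereal 0"
      using fin r(1) by (intro tendsto_add_ereal_general tendsto_intros tendsto_ereal) auto
    then have limf: "(\<lambda>j. f (Y j)) \<longlonglongrightarrow> f x0"
      using less_imp_le[OF Y(3)] by (intro lsc_fun_LIMSEQ[OF assms(1) lim(1)]) (auto simp flip: zero_ereal_def)
    \<comment> \<open>This scaling treats bounded and unbounded \<open>V\<close> together: the pairs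
      \<open>(\<mu> j, \<mu> j *\<^sub>R V j)\<close> lie in a compact set, and the limit
      \<open>m\<close> of the factors is 0 exactly when the norms of \<open>V\<close> tend to
      infinity along the subsequence.\<close>
    define \<mu> where "\<mu> j = inverse (1 + norm (V j))" for j
    have \<mu>: "\<mu> j > 0" "\<mu> j \<le> 1" "norm (\<mu> j *\<^sub>R V j) = 1 - \<mu> j" for j
    proof -
      have "1 + norm (V j) > 0" by (simp add: add_pos_nonneg)
      then show "\<mu> j > 0" "\<mu> j \<le> 1" "norm (\<mu> j *\<^sub>R V j) = 1 - \<mu> j"
        by (auto simp: \<mu>_def field_simps)
    qed
    have "(\<mu> j, \<mu> j *\<^sub>R V j) \<in> {0..1} \<times> cball 0 1" for j
      using \<mu>[of j] by (simp add: less_imp_le)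
    then have mem: "\<forall>j. (\<mu> j, \<mu> j *\<^sub>R V j) \<in> {0..1} \<times> cball 0 1" by blast
    have "seq_compact ({0..1::real} \<times> cball (0::'a) 1)"
      by (intro compact_imp_seq_compact compact_Times) auto
    then obtain l s where l: "strict_mono (s :: nat \<Rightarrow> nat)"
        "((\<lambda>j. (\<mu> j, \<mu> j *\<^sub>R V j)) \<circ> s) \<longlonglongrightarrow> l"
      using mem by (rule seq_compactE)
    define m u where "m = fst l" and "u = snd l"
    have lim\<mu>: "(\<lambda>j. \<mu> (s j)) \<longlonglongrightarrow> m" "(\<lambda>j. \<mu> (s j) *\<^sub>R V (s j)) \<longlonglongrightarrow> u"
      using tendsto_fst[OF l(2)] tendsto_snd[OF l(2)] by (simp_all add: m_def u_def o_def)
    have lims: "(\<lambda>j. Y (s j)) \<longlonglongrightarrow> x0" "(\<lambda>j. Z (s j)) \<longlonglongrightarrow> x0" "(\<lambda>j. Y' (s j)) \<longlonglongrightarrow> x0"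
        "(\<lambda>j. E (s j)) \<longlonglongrightarrow> 0" "(\<lambda>j. V (s j) + n (s j)) \<longlonglongrightarrow> 0" "(\<lambda>j. f (Y (s j))) \<longlonglongrightarrow> f x0"
      using lim[THEN LIMSEQ_subseq_LIMSEQ, OF l(1)] limf[THEN LIMSEQ_subseq_LIMSEQ, OF l(1)]
      by (simp_all add: o_def)
    have "(\<lambda>j. \<mu> (s j) *\<^sub>R (V (s j) + n (s j)) - \<mu> (s j) *\<^sub>R V (s j)) \<longlonglongrightarrow> m *\<^sub>R 0 - u"
      by (intro tendsto_intros lims lim\<mu>)
    then have limn: "(\<lambda>j. \<mu> (s j) *\<^sub>R n (s j)) \<longlonglongrightarrow> - u"
      by (simp add: scaleR_add_right)
    \<comment> \<open>The scaled \<open>n\<close> tend to \<open>- u\<close> because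
      \<open>V + n\<close> tends to 0. As the factors stay bounded, approximate normality at the
      points \<open>Z (s j)\<close> becomes exact normality at \<open>x0\<close>.\<close>
    have uT: "- u \<bullet> (z' - x0) \<le> 0" if z': "z' \<in> T" for z'
    proof (rule LIMSEQ_le)
      show "(\<lambda>j. (\<mu> (s j) *\<^sub>R n (s j)) \<bullet> (z' - Z (s j))) \<longlonglongrightarrow> - u \<bullet> (z' - x0)"
        by (intro tendsto_intros limn lims)
      have "(\<lambda>j. \<mu> (s j) * (E (s j) * norm (z' - Z (s j)))) \<longlonglongrightarrow> m * (0 * norm (z' - x0))"
        by (intro tendsto_intros lim\<mu> lims)
      then show "(\<lambda>j. \<mu> (s j) * (E (s j) * norm (z' - Z (s j)))) \<longlonglongrightarrow> 0" by simp
      show "\<exists>N. \<forall>j\<ge>N. (\<mu> (s j) *\<^sub>R n (s j)) \<bullet> (z' - Z (s j)) \<le> \<mu> (s j) * (E (s j) * norm (z' - Z (s j)))"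
        using n[OF z'] \<mu>(1) by (simp add: mult_left_mono less_imp_le)
    qed
    have "m \<ge> 0"
      using lim\<mu>(1) by (rule LIMSEQ_le_const) (use \<mu>(1) less_imp_le in blast)
    then consider "m = 0" | "m > 0" by linarith
    then show False
    proof cases
      \<comment> \<open>The subgradients blow up, and \<open>u\<close> is a horizon subgradient with
        \<open>- u \<in> N\<close>, hence zero, although its norm is
        \<open>1 - m = 1\<close>.\<close>
      case 1
      have "u \<in> horizon_subdiff f x0"
        unfolding horizon_subdiff_def mem_Collect_eq
        using fin Y(1) lims(1,6) \<mu>(1) lim\<mu>[unfolded 1]
        by (intro conjI exI[of _ "\<lambda>j. Y (s j)"] exI[of _ "\<lambda>j. V (s j)"] exI[of _ "\<lambda>j. \<mu> (s j)"]) auto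
      moreover have "- u \<in> N"
        using uT by (rule normal)
      then have "u \<in> uminus ` N" by force
      ultimately have "u = 0" using hor by blast
      have "(\<lambda>j. norm (\<mu> (s j) *\<^sub>R V (s j))) \<longlonglongrightarrow> norm u"
        by (intro tendsto_intros lim\<mu>)
      moreover have "(\<lambda>j. norm (\<mu> (s j) *\<^sub>R V (s j))) \<longlonglongrightarrow> 1 - m"
        unfolding \<mu>(3) by (intro tendsto_intros lim\<mu>)
      ultimately have "norm u = 1 - m"
        by (rule LIMSEQ_unique)
      with 1 \<open>u = 0\<close> show False by simp
    next
      case 2
      \<comment> \<open>The scaling can be undone in the limit, so \<open>V\<close> itself converges
        along the subsequence, and its limit is a subgradient at which \<open>f\<close> is
        variationally convex.\<close>
      define v where "v = inverse m *\<^sub>R u"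
      have "(\<lambda>j. inverse (\<mu> (s j)) *\<^sub>R (\<mu> (s j) *\<^sub>R V (s j))) \<longlonglongrightarrow> v"
        unfolding v_def using 2 by (intro tendsto_intros lim\<mu>) simp
      then have limV: "(\<lambda>j. V (s j)) \<longlonglongrightarrow> v"
        using \<mu>(1) by (simp add: less_imp_neq[THEN not_sym])
      have "v \<in> limiting_subdiff f x0"
        unfolding limiting_subdiff_def mem_Collect_eq
        using fin Y(1) lims(1,6) limV
        by (intro conjI exI[of _ "\<lambda>j. Y (s j)"] exI[of _ "\<lambda>j. V (s j)"]) auto
      moreover have "- v \<in> N"
        using uT 2 by (intro normal) (simp add: v_def mult_le_0_iff flip: minus_mult_right)
      ultimately have "variationally_convex f x0 v" by (rule vc)
      then obtain A B \<epsilon> where A: "open A" "x0 \<in> A" "open B" "v \<in> B" "\<epsilon> > 0"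
        "\<And>y v y'. \<lbrakk>y \<in> A; v \<in> B; f y < f x0 + ereal \<epsilon>; v \<in> limiting_subdiff f y; y' \<in> A\<rbrakk> \<Longrightarrow>
           f y + ereal (v \<bullet> (y' - y)) \<le> f y'"
        by (rule variationally_convex_subgradient) blast
      have "f x0 < f x0 + ereal \<epsilon>"
        using fin A(5) by (cases "f x0") auto
      then have "\<forall>\<^sub>F j in sequentially. Y (s j) \<in> A \<and> Y' (s j) \<in> A \<and> V (s j) \<in> B \<and> f (Y (s j)) < f x0 + ereal \<epsilon>"
        using A(1-4) lims(1,3,6) limV
        by (intro eventually_conj) (auto intro: topological_tendstoD order_tendstoD)
      from eventually_happens'[OF sequentially_bot this] obtain j where
        "Y (s j) \<in> A" "Y' (s j) \<in> A" "V (s j) \<in> B" "f (Y (s j)) < f x0 + ereal \<epsilon>"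
        by blast
      then have "f (Y (s j)) + ereal (V (s j) \<bullet> (Y' (s j) - Y (s j))) \<le> f (Y' (s j))"
        using A(6) Y(1) regular_subdiff_subset_limiting by blast
      with Y'(2) show False by blast
    qed
  qed
  then show ?thesis unfolding P_def by (simp only: de_Morgan_conj not_not imp_conv_disj disj_assoc)
qed

text \<open>For a regular subgradient, \<open>w = (w - n) + n\<close>: the uniform inequality
  applies to \<open>w - n\<close>, near-normality to \<open>n\<close>, and the splitting error
  \<open>\<eta>\<close> tends to 0 with \<open>\<delta>\<close> fixed. Limiting subgradients are
  then reached by approximation.\<close>

lemma sum_indicator_subgradient_inequality:
  fixes f :: "'a::euclidean_space \<Rightarrow> ereal"
  assumes "lsc_fun f" and f_minf: "\<And>x. f x \<noteq> -\<infinity>" and fin: "\<bar>f x0\<bar> \<noteq> \<infinity>"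
    and "closed S" "x0 \<in> S" "open W" "x0 \<in> W" "convex (S \<inter> W)"
    and "\<And>v. v \<in> limiting_subdiff f x0 \<Longrightarrow> - v \<in> N \<Longrightarrow> variationally_convex f x0 v"
    and "horizon_subdiff f x0 \<inter> uminus ` N \<subseteq> {0}"
    and "\<And>\<nu>. (\<And>z. z \<in> S \<inter> W \<Longrightarrow> \<nu> \<bullet> (z - x0) \<le> 0) \<Longrightarrow> \<nu> \<in> N"
  defines "\<phi> \<equiv> \<lambda>x. f x + indicator_inf S x"
  obtains \<delta> where "\<delta> > 0"
    "\<And>x w y. \<lbrakk>w \<in> limiting_subdiff \<phi> x; norm (x - x0) < \<delta>; \<phi> x < \<phi> x0 + ereal \<delta>; norm w < \<delta>;
       norm (y - x0) < \<delta>\<rbrakk> \<Longrightarrow> \<phi> x + ereal (w \<bullet> (y - x)) \<le> \<phi> y"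
proof -
  have \<phi>_in: "\<phi> x = f x" if "x \<in> S" for x
    using that by (simp add: \<phi>_def indicator_inf_def)
  have \<phi>_out: "\<phi> x = \<infinity>" if "x \<notin> S" for x
    using that f_minf[of x] by (simp add: \<phi>_def indicator_inf_def)
  have "\<exists>\<delta>>0. \<forall>y v z n \<eta> y'. v \<in> regular_subdiff f y \<and> norm (y - x0) < \<delta> \<and>
     f y < f x0 + ereal \<delta> \<and> norm (z - x0) < \<delta> \<and> 0 \<le> \<eta> \<and> \<eta> < \<delta> \<and>
     (\<forall>z'\<in>S \<inter> W. n \<bullet> (z' - z) \<le> \<eta> * norm (z' - z)) \<and> norm (v + n) < \<delta> \<and> norm (y' - x0) < \<delta> \<longrightarrow>
     f y + ereal (v \<bullet> (y' - y)) \<le> f y'"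
    by (rule uniform_subgradient_inequality[where T = "S \<inter> W", OF assms(1) fin assms(9-11)])
  then obtain \<delta>1 where \<delta>1: "\<delta>1 > 0"
    "\<forall>y v z n \<eta> y'. v \<in> regular_subdiff f y \<and> norm (y - x0) < \<delta>1 \<and>
     f y < f x0 + ereal \<delta>1 \<and> norm (z - x0) < \<delta>1 \<and> 0 \<le> \<eta> \<and> \<eta> < \<delta>1 \<and>
     (\<forall>z'\<in>S \<inter> W. n \<bullet> (z' - z) \<le> \<eta> * norm (z' - z)) \<and> norm (v + n) < \<delta>1 \<and> norm (y' - x0) < \<delta>1 \<longrightarrow>
     f y + ereal (v \<bullet> (y' - y)) \<le> f y'"
    by (elim exE conjE)
  obtain \<delta>2 where \<delta>2: "\<delta>2 > 0" "ball x0 \<delta>2 \<subseteq> W"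
    using assms(6,7) open_contains_ball by blast
  define \<delta> where "\<delta> = min \<delta>1 \<delta>2"
  have \<delta>: "\<delta> > 0" "\<delta> \<le> \<delta>1" "\<And>x. norm (x - x0) < \<delta> \<Longrightarrow> x \<in> W"
    using \<delta>1(1) \<delta>2 by (auto simp: \<delta>_def dist_norm norm_minus_commute)
  have reg: "\<phi> x + ereal (w \<bullet> (y - x)) \<le> \<phi> y"
    if w: "w \<in> regular_subdiff \<phi> x" and x: "norm (x - x0) < \<delta>" "\<phi> x < \<phi> x0 + ereal \<delta>"
      and wn: "norm w < \<delta>" and y: "norm (y - x0) < \<delta>" for x w y
  proof (cases "y \<in> S \<and> f y \<noteq> \<infinity>")
    case False
    then show ?thesis using \<phi>_in[of y] \<phi>_out[of y] by (cases "y \<in> S") auto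
  next
    case True
    then obtain b where b: "f y = ereal b" using f_minf[of y] by (cases "f y") auto
    have "\<phi> x \<noteq> \<infinity>" using w by (auto simp: regular_subdiff_def)
    then have xS: "x \<in> S" using \<phi>_out by blast
    then have "f x \<noteq> \<infinity>" using \<open>\<phi> x \<noteq> \<infinity>\<close> \<phi>_in by simp
    then obtain a where a: "f x = ereal a" using f_minf[of x] by (cases "f x") auto
    obtain a0 where a0: "f x0 = ereal a0" using fin by auto
    have ax: "a < a0 + \<delta>" using x(2) xS \<open>x0 \<in> S\<close> a a0 \<phi>_in by simp
    define c where "c = 1 + norm w + norm (y - x)"
    \<comment> \<open>The bound \<open>\<delta> - norm (x - x0)\<close> keeps \<open>u\<close> and
      \<open>z\<close> in the ball, and \<open>a0 + \<delta> - a\<close> keeps \<open>f u\<close>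
      below the level. The error \<open>\<eta> * (c + \<eta>)\<close> collects the losses from
      \<open>f u\<close>, from \<open>w \<bullet> (u - x)\<close> and from near-normality of
      \<open>n\<close>.\<close>
    have key: "a + w \<bullet> (y - x) \<le> b + \<eta> * (c + \<eta>)"
      if \<eta>: "\<eta> > 0" "\<eta> < \<delta>" "\<eta> < \<delta> - norm (x - x0)" "\<eta> < a0 + \<delta> - a" for \<eta>
    proof -
      obtain u z k where u: "k \<ge> 0" "norm (u - x) < \<eta>" "norm (z - x) < \<eta>" "z \<in> S"
        "f x - ereal \<eta> < f u" "f u < f x + ereal \<eta>" "w - k *\<^sub>R (u - z) \<in> regular_subdiff f u"
        "\<forall>z'\<in>S \<inter> W. (k *\<^sub>R (u - z)) \<bullet> (z' - z) \<le> \<eta> * norm (z' - z)"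
        by (rule regular_subdiff_indicator_fuzzy[OF assms(1) f_minf assms(4,8,6) \<delta>(3)[OF x(1)]
            w[unfolded \<phi>_def] \<eta>(1) \<eta>(1)])
      define n where "n = k *\<^sub>R (u - z)"
      obtain e where e: "f u = ereal e" using u(6) f_minf[of u] a by (cases "f u") auto
      have "f u + ereal ((w - n) \<bullet> (y - u)) \<le> f y"
      proof (rule \<delta>1(2)[rule_format], intro conjI)
        show "w - n \<in> regular_subdiff f u" using u(7) by (simp add: n_def)
        show "norm (u - x0) < \<delta>1" "norm (z - x0) < \<delta>1"
          using norm_triangle_ineq[of "u - x" "x - x0"] norm_triangle_ineq[of "z - x" "x - x0"] u(2,3) \<eta>(3) \<delta>(2)
          by auto
        show "f u < f x0 + ereal \<delta>1" using u(6) a a0 e \<eta>(4) \<delta>(2) by simp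
        show "\<forall>z'\<in>S \<inter> W. n \<bullet> (z' - z) \<le> \<eta> * norm (z' - z)"
          using u(8) by (simp add: n_def)
      qed (use \<eta> \<delta>(2) wn y in auto)
      then have "e + (w - n) \<bullet> (y - u) \<le> b" by (simp add: e b)
      moreover have "(w - n) \<bullet> (y - u) = w \<bullet> (y - x) - w \<bullet> (u - x) - n \<bullet> (y - z) + n \<bullet> (u - z)"
        by (simp add: inner_diff_left inner_diff_right)
      \<comment> \<open>The term with the uncontrolled factor \<open>k\<close> has the favourable
        sign: it equals \<open>k * (norm (u - z))^2\<close>.\<close>
      moreover have "n \<bullet> (u - z) \<ge> 0" using u(1) by (simp add: n_def)
      moreover have "n \<bullet> (y - z) \<le> \<eta> * norm (y - z)"
        using u(8)[rule_format, of y] True \<delta>(3)[OF y] by (simp add: n_def)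
      moreover have "norm (y - z) \<le> norm (y - x) + \<eta>"
        using norm_triangle_ineq4[of "y - x" "z - x"] u(3) by simp
      then have "\<eta> * norm (y - z) \<le> \<eta> * (norm (y - x) + \<eta>)"
        using \<eta>(1) by (intro mult_left_mono) auto
      moreover have "w \<bullet> (u - x) \<le> norm w * \<eta>"
        using norm_cauchy_schwarz[of w "u - x"] u(2) by (meson less_imp_le mult_left_mono norm_ge_zero order_trans)
      moreover have "a - \<eta> < e" using u(5) a e by simp
      ultimately show ?thesis by (simp add: c_def algebra_simps)
    qed
    have "a + w \<bullet> (y - x) \<le> b"
    proof (rule tendsto_lowerbound)
      show "((\<lambda>\<eta>. b + \<eta> * (c + \<eta>)) \<longlongrightarrow> b) (at_right 0)"
        by (auto intro!: tendsto_eq_intros)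
      define m where "m = min \<delta> (min (\<delta> - norm (x - x0)) (a0 + \<delta> - a))"
      have "m > 0" using \<delta>(1) x(1) ax by (simp add: m_def)
      then have "\<forall>\<^sub>F \<eta> in at_right 0. \<eta> \<in> {0<..<m}"
        by (rule eventually_at_right_real)
      then show "\<forall>\<^sub>F \<eta> in at_right 0. a + w \<bullet> (y - x) \<le> b + \<eta> * (c + \<eta>)"
        by eventually_elim (intro key; simp add: m_def)
    qed simp
    then show ?thesis using True xS \<phi>_in a b by simp
  qed
  show thesis
  proof (rule that[OF \<delta>(1)])
    fix x w y
    assume w: "w \<in> limiting_subdiff \<phi> x" and x: "norm (x - x0) < \<delta>" "\<phi> x < \<phi> x0 + ereal \<delta>"
      and wn: "norm w < \<delta>" and y: "norm (y - x0) < \<delta>"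
    obtain X V where X: "\<bar>\<phi> x\<bar> \<noteq> \<infinity>" "\<And>k. V k \<in> regular_subdiff \<phi> (X k)" "X \<longlonglongrightarrow> x"
      "(\<lambda>k. \<phi> (X k)) \<longlonglongrightarrow> \<phi> x" "V \<longlonglongrightarrow> w"
      using w by (elim limiting_subdiffE) (rule that, auto)
    \<comment> \<open>All localizing conditions are strict, so the regular subgradients
      approximating \<open>w\<close> eventually satisfy them too.\<close>
    have "(\<lambda>k. norm (X k - x0)) \<longlonglongrightarrow> norm (x - x0)" "(\<lambda>k. norm (V k)) \<longlonglongrightarrow> norm w"
      by (intro tendsto_intros X)+
    then have "\<forall>\<^sub>F k in sequentially. norm (X k - x0) < \<delta>" "\<forall>\<^sub>F k in sequentially. norm (V k) < \<delta>"
      "\<forall>\<^sub>F k in sequentially. \<phi> (X k) < \<phi> x0 + ereal \<delta>"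
      using x wn X(4) by (auto intro: order_tendstoD)
    then have "\<forall>\<^sub>F k in sequentially. \<phi> (X k) + ereal (V k \<bullet> (y - X k)) \<le> \<phi> y"
      by eventually_elim (rule reg[OF X(2) _ _ _ y])
    then show "\<phi> x + ereal (w \<bullet> (y - x)) \<le> \<phi> y"
      by (rule subgradient_ineq_limit[OF X(1,3,4,5)])
  qed
qed

section \<open>Convex minorants as suprema of affine functions\<close>

lemma convex_fun_SUP_affine: "convex_fun (\<lambda>y. SUP p\<in>T. ereal (c p + v p \<bullet> y))"
proof -
  have "{(y, t). (SUP p\<in>T. ereal (c p + v p \<bullet> y)) \<le> ereal t} = (\<Inter>p\<in>T. {(y, t). c p + v p \<bullet> y \<le> t})"
    by (auto simp: SUP_le_iff)
  moreover have "convex {(y, t). c p + v p \<bullet> y \<le> t}" for p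
  proof -
    have "{(y, t). c p + v p \<bullet> y \<le> t} = {q. (v p, - 1) \<bullet> q \<le> - c p}"
      by (auto simp: inner_Pair)
    then show ?thesis by (simp add: convex_halfspace_le)
  qed
  ultimately show ?thesis
    unfolding convex_fun_def by (simp add: convex_INT)
qed

lemma lsc_fun_SUP_affine: "lsc_fun (\<lambda>y. SUP p\<in>T. ereal (c p + v p \<bullet> y))"
  unfolding lsc_fun_iff
proof (intro allI impI)
  fix y d assume "d < (SUP p\<in>T. ereal (c p + v p \<bullet> y))"
  then obtain p where p: "p \<in> T" "d < ereal (c p + v p \<bullet> y)"
    by (auto simp: less_SUP_iff)
  have "((\<lambda>z. ereal (c p + v p \<bullet> z)) \<longlongrightarrow> ereal (c p + v p \<bullet> y)) (nhds y)"
    by (intro tendsto_intros tendsto_ereal) (simp add: filterlim_ident)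
  then have "\<forall>\<^sub>F z in nhds y. d < ereal (c p + v p \<bullet> z)"
    using p(2) by (rule order_tendstoD)
  then show "\<forall>\<^sub>F z in nhds y. d < (SUP p\<in>T. ereal (c p + v p \<bullet> z))"
    by eventually_elim (use p(1) less_SUP_iff in blast)
qed

text \<open>The convex minorant is the supremum of the affine functions given by the subgradients near
  \<open>(x0, 0)\<close>. Its subgradients near \<open>(x0, 0)\<close> are no others: if \<open>w\<close> is one at \<open>x\<close>, then minimizing
  \<open>\<phi> - \<langle>w, \<cdot>\<rangle> + \<bar>\<cdot> - x\<bar>\<^sup>2 / 2\<close> near \<open>x0\<close> yields \<open>y\<close> with subgradient \<open>w + x - y\<close>, and monotonicity
  forces \<open>y = x\<close>.\<close>
lemma variationally_convexI:
  fixes \<phi> :: "'a::euclidean_space \<Rightarrow> ereal"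
  assumes "proper_fun \<phi>" "lsc_fun \<phi>" and zero: "0 \<in> limiting_subdiff \<phi> x0" and "\<delta> > 0"
    and ineq: "\<And>x w y. \<lbrakk>w \<in> limiting_subdiff \<phi> x; norm (x - x0) < \<delta>; \<phi> x < \<phi> x0 + ereal \<delta>; norm w < \<delta>;
       norm (y - x0) < \<delta>\<rbrakk> \<Longrightarrow> \<phi> x + ereal (w \<bullet> (y - x)) \<le> \<phi> y"
  shows "variationally_convex \<phi> x0 0"
proof -
  \<comment> \<open>The cap 1 keeps error bounds quadratic in \<open>\<epsilon>\<close> below
    \<open>\<epsilon>\<close>.\<close>
  define \<epsilon> where "\<epsilon> = min \<delta> 1"
  have \<epsilon>: "\<epsilon> > 0" "\<epsilon> \<le> 1" "\<epsilon> \<le> \<delta>" using \<open>\<delta> > 0\<close> by (auto simp: \<epsilon>_def)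
  have "\<bar>\<phi> x0\<bar> \<noteq> \<infinity>" using zero by (simp add: limiting_subdiff_def)
  then obtain a0 where a0: "\<phi> x0 = ereal a0" by auto
  have minf: "\<phi> x \<noteq> -\<infinity>" for x using assms(1) by (auto simp: proper_fun_def)
  define T where "T = {(x, w). w \<in> limiting_subdiff \<phi> x \<and> norm (x - x0) < \<epsilon> \<and> \<phi> x < \<phi> x0 + ereal \<epsilon> \<and> norm w < \<epsilon>}"
  have T0: "(x0, 0) \<in> T" using zero a0 \<epsilon>(1) by (simp add: T_def)
  define h where "h = (\<lambda>y. SUP p\<in>T. ereal ((real_of_ereal (\<phi> (fst p)) - snd p \<bullet> fst p) + snd p \<bullet> y))"
  have T_fin: "\<phi> x = ereal (real_of_ereal (\<phi> x))" if "(x, w) \<in> T" for x w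
    using that by (auto simp: T_def limiting_subdiff_def ereal_real)
  have h_ge: "\<phi> x + ereal (w \<bullet> (y - x)) \<le> h y" if "(x, w) \<in> T" for x w y
  proof -
    have "\<phi> x + ereal (w \<bullet> (y - x)) = ereal (real_of_ereal (\<phi> x) - w \<bullet> x + w \<bullet> y)"
      by (subst T_fin[OF that]) (simp add: inner_diff_right)
    also have "\<dots> \<le> h y" unfolding h_def using that by (intro SUP_upper2) auto
    finally show ?thesis .
  qed
  have h_le: "h y \<le> \<phi> y" if y: "norm (y - x0) < \<epsilon>" for y
    unfolding h_def
  proof (rule SUP_least)
    fix p assume p: "p \<in> T"
    obtain x w where xw: "p = (x, w)" by (cases p)
    with p have xw': "(x, w) \<in> T" by simp
    have "ereal (real_of_ereal (\<phi> x) - w \<bullet> x + w \<bullet> y) = \<phi> x + ereal (w \<bullet> (y - x))"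
      by (subst (2) T_fin[OF xw']) (simp add: inner_diff_right)
    also have "\<dots> \<le> \<phi> y"
    proof (rule ineq)
      have "\<phi> x < \<phi> x0 + ereal \<epsilon>" using xw' by (simp add: T_def)
      also have "\<dots> \<le> \<phi> x0 + ereal \<delta>" using \<epsilon>(3) by (intro add_left_mono) simp
      finally show "\<phi> x < \<phi> x0 + ereal \<delta>" .
    qed (use xw' \<epsilon>(3) y in \<open>auto simp: T_def\<close>)
    finally show "ereal (real_of_ereal (\<phi> (fst p)) - snd p \<bullet> fst p + snd p \<bullet> y) \<le> \<phi> y"
      by (simp add: xw)
  qed
  have h_eq: "h x = \<phi> x" if "(x, w) \<in> T" for x w
  proof (rule antisym)
    show "h x \<le> \<phi> x" using that by (intro h_le) (simp add: T_def)
    show "\<phi> x \<le> h x" using h_ge[OF that, of x] by simp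
  qed
  have h_convex: "convex_fun h" and h_lsc: "lsc_fun h"
    unfolding h_def by (rule convex_fun_SUP_affine lsc_fun_SUP_affine)+
  \<comment> \<open>Small enough for \<open>r * \<epsilon> + r^2 \<le> (\<epsilon> / 5)^2\<close>,
    which bounds the distance of the minimizer \<open>y\<close> below from \<open>x\<close> by
    \<open>\<epsilon> / 5\<close>. Then \<open>y\<close> is interior to the ball of radius
    \<open>\<epsilon> / 2\<close>, and \<open>w - (y - x)\<close> has norm less than
    \<open>\<epsilon>\<close>.\<close>
  define r where "r = \<epsilon> / 50"
  have r: "r > 0" "r < \<epsilon>" using \<epsilon>(1) by (auto simp: r_def)
  have gph: "(x, w) \<in> T" if x: "norm (x - x0) < r" and w: "norm w < r" and "w \<in> limiting_subdiff h x" for x w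
  proof -
    have sub: "h x + ereal (w \<bullet> (y - x)) \<le> h y" for y
      using convex_limiting_subgradient[OF h_convex that(3)] .
    have "\<bar>h x\<bar> \<noteq> \<infinity>" using that(3) by (simp add: limiting_subdiff_def)
    then obtain c where c: "h x = ereal c" by auto
    have "\<exists>y\<in>cball x0 (\<epsilon> / 2). \<forall>u\<in>cball x0 (\<epsilon> / 2).
        \<phi> y + ereal (1 / 2 * (norm (y - x))\<^sup>2 - w \<bullet> y) \<le> \<phi> u + ereal (1 / 2 * (norm (u - x))\<^sup>2 - w \<bullet> u)"
      using \<epsilon>(1) by (intro lsc_fun_attains_min lsc_fun_add_continuous assms(2) continuous_intros) auto
    then obtain y where y_cball: "y \<in> cball x0 (\<epsilon> / 2)"
      and min_cball: "\<forall>u\<in>cball x0 (\<epsilon> / 2).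
        \<phi> y + ereal (1 / 2 * (norm (y - x))\<^sup>2 - w \<bullet> y) \<le> \<phi> u + ereal (1 / 2 * (norm (u - x))\<^sup>2 - w \<bullet> u)"
      by blast
    have y: "norm (y - x0) \<le> \<epsilon> / 2"
      using y_cball by (simp add: dist_norm norm_minus_commute)
    have min: "\<phi> y + ereal (1 / 2 * (norm (y - x))\<^sup>2 - w \<bullet> y) \<le> \<phi> u + ereal (1 / 2 * (norm (u - x))\<^sup>2 - w \<bullet> u)"
      if "norm (u - x0) \<le> \<epsilon> / 2" for u
      using min_cball that by (simp add: dist_norm norm_minus_commute)
    have min0: "\<phi> y + ereal (1 / 2 * (norm (y - x))\<^sup>2 - w \<bullet> y) \<le> ereal (a0 + (1 / 2 * (norm (x0 - x))\<^sup>2 - w \<bullet> x0))"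
      using min[of x0] a0 \<epsilon>(1) by simp
    then obtain b where b: "\<phi> y = ereal b"
      using minf[of y] by (cases "\<phi> y") auto
    \<comment> \<open>The pair \<open>(x0, 0)\<close> belongs to \<open>T\<close>, so
      \<open>\<phi>\<close> is at least \<open>\<phi> x0\<close> near \<open>x0\<close>; this lower
      bound is what forces the quadratic term to be small.\<close>
    have "\<phi> x0 + ereal (0 \<bullet> (y - x0)) \<le> h y" by (rule h_ge[OF T0])
    also have "h y \<le> \<phi> y" using y \<epsilon>(1) by (intro h_le) simp
    finally have ab: "a0 \<le> b" using a0 b by simp
    have wy: "w \<bullet> (y - x0) \<le> r * (\<epsilon> / 2)"
    proof -
      have "norm w * norm (y - x0) \<le> r * (\<epsilon> / 2)"
        using w y r by (intro mult_mono) auto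
      then show ?thesis using norm_cauchy_schwarz order_trans by blast
    qed
    have xx: "(norm (x0 - x))\<^sup>2 \<le> r\<^sup>2"
      using x by (intro power_mono) (auto simp: norm_minus_commute)
    have yb: "b + 1 / 2 * (norm (y - x))\<^sup>2 \<le> a0 + r * (\<epsilon> / 2) + r\<^sup>2 / 2"
      using min0 b wy xx by (simp add: inner_diff_right)
    then have "(norm (y - x))\<^sup>2 \<le> r * \<epsilon> + r\<^sup>2" using ab by simp
    also have "\<dots> \<le> (\<epsilon> / 5)\<^sup>2" by (simp add: r_def power2_eq_square)
    finally have yx: "norm (y - x) \<le> \<epsilon> / 5"
      using \<epsilon>(1) by (simp add: power2_le_iff_abs_le)
    have y_in: "norm (y - x0) < \<epsilon> / 2"
      using norm_triangle_ineq[of "y - x" "x - x0"] yx x \<epsilon>(1) by (simp add: r_def)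
    have "r * (\<epsilon> / 2) + r\<^sup>2 / 2 < \<epsilon>"
    proof -
      have "r * (\<epsilon> / 2) + r\<^sup>2 / 2 = \<epsilon> * (\<epsilon> * (51 / 5000))" by (simp add: r_def power2_eq_square)
      also have "\<dots> < \<epsilon> * 1" using \<epsilon> by (intro mult_strict_left_mono) auto
      finally show ?thesis by simp
    qed
    then have "b + 1 / 2 * (norm (y - x))\<^sup>2 < a0 + \<epsilon>" using yb by linarith
    then have "b < a0 + \<epsilon>" using zero_le_power2[of "norm (y - x)"] by linarith
    then have \<phi>y: "\<phi> y < \<phi> x0 + ereal \<epsilon>" by (simp add: a0 b)
    have "w - 1 *\<^sub>R (y - x) \<in> regular_subdiff \<phi> y"
    proof (rule regular_subdiff_of_prox_min)
      have "\<forall>\<^sub>F u in nhds y. u \<in> ball x0 (\<epsilon> / 2)"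
        using y_in by (intro eventually_nhds_in_open) (auto simp: dist_norm norm_minus_commute)
      then show "\<forall>\<^sub>F u in nhds y. \<phi> y + ereal (1 / 2 * (norm (y - x))\<^sup>2 - w \<bullet> y) \<le>
          \<phi> u + ereal (1 / 2 * (norm (u - x))\<^sup>2 - w \<bullet> u)"
        by eventually_elim (intro min, auto simp: dist_norm norm_minus_commute)
    qed (use b in auto)
    then have "w - (y - x) \<in> limiting_subdiff \<phi> y"
      using regular_subdiff_subset_limiting by auto
    moreover have "norm (w - (y - x)) < \<epsilon>"
      using norm_triangle_ineq4[of w "y - x"] w yx \<epsilon>(1) by (simp add: r_def)
    ultimately have yT: "(y, w - (y - x)) \<in> T"
      using y_in \<phi>y \<epsilon>(1) by (simp add: T_def)
    \<comment> \<open>Both inequalities concern \<open>h\<close>: the affine minorant from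
      \<open>(y, w - (y - x))\<close> is evaluated at \<open>x\<close>, the one from
      \<open>(x, w)\<close> at \<open>y\<close>. Adding them leaves
      \<open>(norm (y - x))^2 \<le> 0\<close>.\<close>
    have "ereal b + ereal ((w - (y - x)) \<bullet> (x - y)) \<le> ereal c"
      using h_ge[OF yT, of x] b c by simp
    moreover have "ereal c + ereal (w \<bullet> (y - x)) \<le> ereal b"
      using sub[of y] h_eq[OF yT] b c by simp
    moreover have "(w - (y - x)) \<bullet> (x - y) + w \<bullet> (y - x) = (y - x) \<bullet> (y - x)"
      by (simp add: inner_diff_left inner_diff_right)
    ultimately have "(y - x) \<bullet> (y - x) \<le> 0" by simp
    then have "(y - x) \<bullet> (y - x) = 0" using inner_ge_zero[of "y - x"] by linarith
    then have "y = x" by simp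
    with yT show ?thesis by simp
  qed
  have eq: "({x \<in> ball x0 r. \<phi> x < \<phi> x0 + ereal \<epsilon>} \<times> ball 0 r) \<inter> gph_subdiff \<phi> =
      (ball x0 r \<times> ball 0 r) \<inter> gph_subdiff h" (is "?L = ?R")
  proof (intro equalityI subsetI)
    fix q assume "q \<in> ?L"
    then obtain x w where q: "q = (x, w)" "norm (x - x0) < r" "norm w < r" "\<phi> x < \<phi> x0 + ereal \<epsilon>"
        "w \<in> limiting_subdiff \<phi> x"
      by (auto simp: gph_subdiff_def dist_norm norm_minus_commute)
    then have xw: "(x, w) \<in> T" using r by (simp add: T_def)
    obtain c where "\<phi> x = ereal c" using T_fin[OF xw] by blast
    then have "w \<in> regular_subdiff h x"
      using h_ge[OF xw] h_eq[OF xw] by (intro regular_subdiff_of_global) auto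
    then have "w \<in> limiting_subdiff h x" using regular_subdiff_subset_limiting by blast
    with q show "q \<in> ?R" by (auto simp: gph_subdiff_def dist_norm norm_minus_commute)
  next
    fix q assume "q \<in> ?R"
    then obtain x w where q: "q = (x, w)" "norm (x - x0) < r" "norm w < r" "w \<in> limiting_subdiff h x"
      by (auto simp: gph_subdiff_def dist_norm norm_minus_commute)
    then have "(x, w) \<in> T" by (intro gph)
    with q show "q \<in> ?L" by (auto simp: gph_subdiff_def T_def dist_norm norm_minus_commute)
  qed
  have "\<phi> x = h x" if "(x, w) \<in> (ball x0 r \<times> ball 0 r) \<inter> gph_subdiff h" for x w
  proof -
    have "(x, w) \<in> T"
      using that by (intro gph) (auto simp: gph_subdiff_def dist_norm norm_minus_commute)
    then show ?thesis by (simp add: h_eq)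
  qed
  then have "\<forall>(x, w) \<in> (ball x0 r \<times> ball 0 r) \<inter> gph_subdiff h. \<phi> x = h x" by blast
  moreover have "\<forall>x\<in>ball x0 r. h x \<le> \<phi> x"
    using h_le r by (auto simp: dist_norm norm_minus_commute)
  moreover have "x0 \<in> dom_fun \<phi>" using a0 by (simp add: dom_fun_def)
  ultimately show ?thesis
    unfolding variationally_convex_def
    using assms(1,2) zero h_convex h_lsc eq r(1) \<epsilon>(1)
    by (intro conjI exI[of _ "ball x0 r"] exI[of _ "ball 0 r"] exI[of _ h] exI[of _ \<epsilon>]) auto
qed

section \<open>Normals of the feasible set\<close>

text \<open>Otherwise the convex hull of \<open>- \<nu>\<close> and the \<open>a i\<close>, \<open>i \<in> A\<close>, misses the span of the \<open>a i\<close>, \<open>i \<in> B\<close>,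
  and a hyperplane separating the two gives a direction \<open>d\<close> with \<open>\<nu> \<bullet> d > 0\<close>.\<close>
lemma positive_multipliers_exist:
  fixes a :: "'p::finite \<Rightarrow> 'a::euclidean_space"
  assumes disj: "A \<inter> B = {}"
    and plicq: "\<And>u. (\<Sum>i\<in>A \<union> B. u i *\<^sub>R a i) = 0 \<Longrightarrow> \<forall>i\<in>A. u i \<ge> 0 \<Longrightarrow> \<forall>i\<in>A \<union> B. u i = 0"
    and dir: "\<And>d. \<forall>i\<in>A. a i \<bullet> d < 0 \<Longrightarrow> \<forall>i\<in>B. a i \<bullet> d = 0 \<Longrightarrow> \<nu> \<bullet> d \<le> 0"
  shows "\<exists>u. (\<forall>i\<in>A. u i \<ge> 0) \<and> \<nu> = (\<Sum>i\<in>A \<union> B. u i *\<^sub>R a i)"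
proof (rule ccontr)
  assume no: "\<not> ?thesis"
  define H where "H = convex hull (insert (- \<nu>) (a ` A))"
  define L where "L = span (a ` B)"
  \<comment> \<open>A convex set containing \<open>H\<close> whose points carry explicit
    coefficients indexed by \<open>A\<close>, also where some \<open>a i\<close> coincide.
    Positivity of the total weight stands in for normalization to 1 and rules out trivial
    relations.\<close>
  define Q where "Q = {(\<Sum>i\<in>A. u i *\<^sub>R a i) - t *\<^sub>R \<nu> | u t. (\<forall>i\<in>A. u i \<ge> 0) \<and> t \<ge> 0 \<and> t + sum u A > 0}"
  have merge: "(\<Sum>i\<in>A \<union> B. (if i \<in> A then u i else w i) *\<^sub>R a i) =
      (\<Sum>i\<in>A. u i *\<^sub>R a i) + (\<Sum>i\<in>B. w i *\<^sub>R a i)" for u w :: "'p \<Rightarrow> real"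
  proof -
    have "(\<Sum>i\<in>A \<union> B. (if i \<in> A then u i else w i) *\<^sub>R a i) =
        (\<Sum>i\<in>A. (if i \<in> A then u i else w i) *\<^sub>R a i) + (\<Sum>i\<in>B. (if i \<in> A then u i else w i) *\<^sub>R a i)"
      using disj by (intro sum.union_disjoint) auto
    moreover have "(\<Sum>i\<in>B. (if i \<in> A then u i else w i) *\<^sub>R a i) = (\<Sum>i\<in>B. w i *\<^sub>R a i)"
      using disj by (intro sum.cong) auto
    ultimately show ?thesis by simp
  qed
  have "convex Q"
    unfolding convex_def
  proof (intro ballI allI impI)
    fix x y and p q :: real
    assume "x \<in> Q" "y \<in> Q" and pq: "p \<ge> 0" "q \<ge> 0" "p + q = 1"
    then obtain u t u' t' where
      x: "x = (\<Sum>i\<in>A. u i *\<^sub>R a i) - t *\<^sub>R \<nu>" "\<forall>i\<in>A. u i \<ge> 0" "t \<ge> 0" "t + sum u A > 0" and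
      y: "y = (\<Sum>i\<in>A. u' i *\<^sub>R a i) - t' *\<^sub>R \<nu>" "\<forall>i\<in>A. u' i \<ge> 0" "t' \<ge> 0" "t' + sum u' A > 0"
      unfolding Q_def by blast
    have "p * (t + sum u A) + q * (t' + sum u' A) > 0"
    proof (cases "p = 0")
      case False
      with pq x(4) y(4) show ?thesis by (intro add_pos_nonneg) auto
    qed (use pq y(4) in simp)
    then have "(p * t + q * t') + sum (\<lambda>i. p * u i + q * u' i) A > 0"
      by (simp add: sum.distrib sum_distrib_left algebra_simps)
    moreover have "p *\<^sub>R x + q *\<^sub>R y = (\<Sum>i\<in>A. (p * u i + q * u' i) *\<^sub>R a i) - (p * t + q * t') *\<^sub>R \<nu>"
      by (simp add: x y scaleR_diff_right scaleR_add_left sum.distrib scaleR_sum_right)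
    ultimately show "p *\<^sub>R x + q *\<^sub>R y \<in> Q"
      unfolding Q_def mem_Collect_eq using x(2,3) y(2,3) pq
      by (intro exI[of _ "\<lambda>i. p * u i + q * u' i"] exI[of _ "p * t + q * t'"]) auto
  qed
  moreover have "insert (- \<nu>) (a ` A) \<subseteq> Q"
  proof
    fix x assume "x \<in> insert (- \<nu>) (a ` A)"
    then consider "x = - \<nu>" | j where "j \<in> A" "x = a j" by blast
    then show "x \<in> Q"
    proof cases
      case 1
      then show ?thesis unfolding Q_def mem_Collect_eq
        by (intro exI[of _ "\<lambda>_. 0"] exI[of _ 1]) auto
    next
      case 2
      then have "(\<Sum>i\<in>A. (if i = j then 1 else 0) *\<^sub>R a i) = a j" "sum (\<lambda>i. if i = j then 1 else 0::real) A = 1"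
        by (simp_all add: if_distrib[of "\<lambda>c. c *\<^sub>R _"] cong: if_cong)
      with 2 show ?thesis unfolding Q_def mem_Collect_eq
        by (intro exI[of _ "\<lambda>i. if i = j then 1 else 0"] exI[of _ 0]) auto
    qed
  qed
  ultimately have "H \<subseteq> Q"
    unfolding H_def by (intro hull_minimal)
  have L: "L \<subseteq> {\<Sum>i\<in>B. w i *\<^sub>R a i | w. True}"
    unfolding L_def
  proof (rule span_minimal)
    show "a ` B \<subseteq> {\<Sum>i\<in>B. w i *\<^sub>R a i | w. True}"
    proof
      fix x assume "x \<in> a ` B"
      then obtain j where j: "j \<in> B" "x = a j" by blast
      then have "(\<Sum>i\<in>B. (if i = j then 1 else 0) *\<^sub>R a i) = x"
        by (simp add: if_distrib[of "\<lambda>c. c *\<^sub>R _"] cong: if_cong)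
      then show "x \<in> {\<Sum>i\<in>B. w i *\<^sub>R a i | w. True}"
        unfolding mem_Collect_eq by (intro exI[of _ "\<lambda>i. if i = j then 1 else 0"]) simp
    qed
    show "subspace {\<Sum>i\<in>B. w i *\<^sub>R a i | w. True}"
    proof (rule subspaceI)
      show "0 \<in> {\<Sum>i\<in>B. w i *\<^sub>R a i | w. True}"
        unfolding mem_Collect_eq by (intro exI[of _ "\<lambda>_. 0"]) simp
    next
      fix x y
      assume "x \<in> {\<Sum>i\<in>B. w i *\<^sub>R a i | w. True}" "y \<in> {\<Sum>i\<in>B. w i *\<^sub>R a i | w. True}"
      then obtain w w' where "x = (\<Sum>i\<in>B. w i *\<^sub>R a i)" "y = (\<Sum>i\<in>B. w' i *\<^sub>R a i)" by blast
      then have "x + y = (\<Sum>i\<in>B. (w i + w' i) *\<^sub>R a i)"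
        by (simp add: scaleR_add_left sum.distrib)
      then show "x + y \<in> {\<Sum>i\<in>B. w i *\<^sub>R a i | w. True}"
        unfolding mem_Collect_eq by (intro exI[of _ "\<lambda>i. w i + w' i"]) simp
    next
      fix c x assume "x \<in> {\<Sum>i\<in>B. w i *\<^sub>R a i | w. True}"
      then obtain w where "x = (\<Sum>i\<in>B. w i *\<^sub>R a i)" by blast
      then have "c *\<^sub>R x = (\<Sum>i\<in>B. (c * w i) *\<^sub>R a i)"
        by (simp add: scaleR_sum_right)
      then show "c *\<^sub>R x \<in> {\<Sum>i\<in>B. w i *\<^sub>R a i | w. True}"
        unfolding mem_Collect_eq by (intro exI[of _ "\<lambda>i. c * w i"]) simp
    qed
  qed
  have "H \<inter> L = {}"
  proof (rule ccontr)
    assume "H \<inter> L \<noteq> {}"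
    then obtain x where "x \<in> Q" "x \<in> L" using \<open>H \<subseteq> Q\<close> by blast
    then obtain u t w where u: "\<forall>i\<in>A. u i \<ge> 0" "t \<ge> 0" "t + sum u A > 0"
      and eq: "(\<Sum>i\<in>A. u i *\<^sub>R a i) - t *\<^sub>R \<nu> = (\<Sum>i\<in>B. w i *\<^sub>R a i)"
      using L unfolding Q_def by blast
    \<comment> \<open>A common point is a relation with nonnegative, not all vanishing weights on
      \<open>\<nu>\<close> and on \<open>A\<close>. For \<open>t = 0\<close> it contradicts positive
      linear independence; for \<open>t > 0\<close> it can be solved for \<open>\<nu>\<close>,
      contrary to \<open>no\<close>.\<close>
    show False
    proof (cases "t = 0")
      case True
      have "(\<Sum>i\<in>A \<union> B. (if i \<in> A then u i else - w i) *\<^sub>R a i) = 0"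
        unfolding merge using eq True by (simp add: sum_negf)
      then have z: "\<forall>i\<in>A \<union> B. (if i \<in> A then u i else - w i) = 0"
        by (rule plicq) (use u in simp)
      have "u i = 0" if "i \<in> A" for i
        using z[rule_format, of i] that by simp
      then have "sum u A = 0" by simp
      with u True show False by simp
    next
      case False
      have "\<nu> = inverse t *\<^sub>R (t *\<^sub>R \<nu>)" using False by simp
      also have "t *\<^sub>R \<nu> = (\<Sum>i\<in>A. u i *\<^sub>R a i) + (\<Sum>i\<in>B. - w i *\<^sub>R a i)"
        using eq by (simp add: sum_negf algebra_simps)
      also have "inverse t *\<^sub>R \<dots> = (\<Sum>i\<in>A. (inverse t * u i) *\<^sub>R a i) + (\<Sum>i\<in>B. (inverse t * - w i) *\<^sub>R a i)"
        by (simp add: scaleR_add_right scaleR_sum_right)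
      also have "\<dots> = (\<Sum>i\<in>A \<union> B. (if i \<in> A then inverse t * u i else inverse t * - w i) *\<^sub>R a i)"
        by (rule merge[symmetric])
      finally show False
        using no u(1,2)
        by (auto dest!: spec[of _ "\<lambda>i. if i \<in> A then inverse t * u i else inverse t * - w i"])
    qed
  qed
  moreover have "compact H" unfolding H_def
    by (intro finite_imp_compact_convex_hull) auto
  moreover have "convex H" "H \<noteq> {}" "convex L" "closed L"
    unfolding H_def L_def by (auto simp: convex_convex_hull closed_span subspace_imp_convex)
  ultimately obtain d b where d: "\<forall>x\<in>H. d \<bullet> x < b" "\<forall>x\<in>L. b < d \<bullet> x"
    using separating_hyperplane_compact_closed[of H L] by blast
  \<comment> \<open>Since \<open>b\<close> is negative, the separation gives the strict descent
    \<open>a i \<bullet> d < 0\<close> that \<open>dir\<close> asks for.\<close>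
  have "0 \<in> L" by (simp add: L_def span_zero)
  with d(2) have "b < 0" by fastforce
  \<comment> \<open>A linear functional bounded below on a subspace vanishes there: otherwise the
    multiple by \<open>b / (d \<bullet> x)\<close> would attain the excluded value
    \<open>b\<close>.\<close>
  have dL: "d \<bullet> x = 0" if "x \<in> L" for x
  proof (rule ccontr)
    assume "d \<bullet> x \<noteq> 0"
    moreover have "(b / (d \<bullet> x)) *\<^sub>R x \<in> L" using that by (simp add: L_def span_scale)
    then have "b < d \<bullet> ((b / (d \<bullet> x)) *\<^sub>R x)" using d(2) by blast
    ultimately show False by simp
  qed
  have "- \<nu> \<in> H" "\<And>i. i \<in> A \<Longrightarrow> a i \<in> H"
    unfolding H_def by (auto intro: hull_inc)
  then have "d \<bullet> (- \<nu>) < b" and dA: "\<forall>i\<in>A. d \<bullet> a i < b" using d(1) by blast+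
  have "\<forall>i\<in>A. a i \<bullet> d < 0"
    using dA \<open>b < 0\<close> by (auto simp: inner_commute intro: less_trans)
  moreover have "\<forall>i\<in>B. a i \<bullet> d = 0"
    using dL by (simp add: inner_commute[of _ d] L_def span_base)
  ultimately have "\<nu> \<bullet> d \<le> 0" by (rule dir)
  with \<open>d \<bullet> (- \<nu>) < b\<close> \<open>b < 0\<close> show False by (simp add: inner_commute)
qed

lemma C1_fun_has_derivative: "C1_fun h \<Longrightarrow> (h has_derivative (\<lambda>d. d \<bullet> gradient h x)) (at x)"
  by (simp add: C1_fun_def gderiv_def)

lemma transpose_jacobian_constraint_map:
  fixes g :: "'b::finite \<Rightarrow> real^'n \<Rightarrow> real"
  assumes "\<And>i. C1_fun (g i)"
  shows "transpose (jacobian (constraint_map g) (at x)) *v w = (\<Sum>i\<in>UNIV. w $ i *\<^sub>R gradient (g i) x)"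
proof -
  define D where "D = (\<lambda>d. \<chi> i. d \<bullet> gradient (g i) x)"
  have D: "(constraint_map g has_derivative D) (at x)"
  proof (subst has_derivative_componentwise_within, rule ballI)
    fix b :: "real^'b" assume "b \<in> Basis"
    then obtain i where "b = axis i 1" by (auto simp: Basis_vec_def)
    then show "((\<lambda>y. constraint_map g y \<bullet> b) has_derivative (\<lambda>d. D d \<bullet> b)) (at x)"
      using C1_fun_has_derivative[OF assms, of i x] by (simp add: inner_axis D_def constraint_map_def)
  qed
  then have "(constraint_map g has_derivative (\<lambda>d. jacobian (constraint_map g) (at x) *v d)) (at x)"
    unfolding jacobian_works[symmetric] by (rule differentiableI)
  then have J: "(\<lambda>d. jacobian (constraint_map g) (at x) *v d) = D"
    using D by (rule has_derivative_unique)
  have "(transpose (jacobian (constraint_map g) (at x)) *v w) \<bullet> d = (\<Sum>i\<in>UNIV. w $ i *\<^sub>R gradient (g i) x) \<bullet> d" for d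
  proof -
    have "(transpose (jacobian (constraint_map g) (at x)) *v w) \<bullet> d = w \<bullet> D d"
      using fun_cong[OF J, of d] by (simp add: transpose_matrix_vector dot_lmul_matrix)
    also have "\<dots> = (\<Sum>i\<in>UNIV. w $ i *\<^sub>R gradient (g i) x) \<bullet> d"
      by (simp add: inner_vec_def[of w] D_def inner_sum_left inner_commute[of d])
    finally show ?thesis .
  qed
  then show ?thesis using vector_eq_rdot by blast
qed

text \<open>A direction that strictly decreases the active inequalities and is tangent to the
  equalities stays feasible for small steps: active inequalities by the sign of the derivative,
  inactive ones by continuity, equalities exactly because they are affine. So \<open>\<nu>\<close>
  is nonpositive on all such directions, and \<open>positive_multipliers_exist\<close>
  applies.\<close>

lemma normal_image_if_normal:
  fixes g :: "'p::finite \<Rightarrow> real^'n \<Rightarrow> real"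
  assumes C1: "\<And>i. C1_fun (g i)" and plicq: "positive_LICQ g I x0"
    and aff: "\<And>i. i \<in> - I \<Longrightarrow> affine_fun (g i)"
    and "x0 \<in> feasible_set g I" "open W" "x0 \<in> W"
    and normal: "\<And>z. z \<in> feasible_set g I \<inter> W \<Longrightarrow> \<nu> \<bullet> (z - x0) \<le> 0"
  shows "\<nu> \<in> normal_image g I x0"
proof -
  define a where "a i = gradient (g i) x0" for i
  define A where "A = active_ineqs g I x0"
  have deriv: "(g i has_derivative (\<lambda>d. d \<bullet> a i)) (at x0)" for i
    using C1_fun_has_derivative[OF C1] by (simp add: a_def)
  have feas: "\<And>i. i \<in> I \<Longrightarrow> g i x0 \<le> 0" "\<And>i. i \<in> - I \<Longrightarrow> g i x0 = 0"
    using assms(4) by (auto simp: feasible_set_def)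
  have "\<nu> \<bullet> d \<le> 0" if dA: "\<forall>i\<in>A. a i \<bullet> d < 0" and dB: "\<forall>i\<in>- I. a i \<bullet> d = 0" for d
  proof -
    have line: "((\<lambda>s::real. x0 + s *\<^sub>R d) \<longlongrightarrow> x0) (at_right 0)"
      by (auto intro!: tendsto_eq_intros)
    have "\<forall>\<^sub>F s in at_right (0::real). i \<in> I \<longrightarrow> g i (x0 + s *\<^sub>R d) \<le> 0" for i
    proof (cases "i \<in> A")
      case True
      have "((\<lambda>s. g i (x0 + s *\<^sub>R d)) has_derivative (\<lambda>s. (s *\<^sub>R d) \<bullet> a i)) (at 0)"
        by (rule has_derivative_compose[of "\<lambda>s. x0 + s *\<^sub>R d" _ 0 UNIV "g i"])
          (use deriv in \<open>auto intro!: derivative_eq_intros\<close>)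
      then have "((\<lambda>s. g i (x0 + s *\<^sub>R d)) has_real_derivative a i \<bullet> d) (at 0)"
        unfolding has_field_derivative_def by (simp add: inner_commute mult_commute_abs)
      then obtain e where e: "e > 0" "\<And>h. h > 0 \<Longrightarrow> h < e \<Longrightarrow> g i (x0 + (0 + h) *\<^sub>R d) < g i (x0 + 0 *\<^sub>R d)"
        using DERIV_neg_dec_right[of "\<lambda>s. g i (x0 + s *\<^sub>R d)" "a i \<bullet> d" 0] dA True by auto
      have "\<forall>\<^sub>F s in at_right 0. s \<in> {0<..<e}" using e(1) by (rule eventually_at_right_real)
      then show ?thesis
      proof eventually_elim
        case (elim s)
        then show ?case using e(2)[of s] True by (auto simp: A_def active_ineqs_def)
      qed
    next
      case False
      show ?thesis
      proof (cases "i \<in> I")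
        case True
        with False feas have "g i x0 < 0" by (fastforce simp: A_def active_ineqs_def)
        moreover have "((\<lambda>s. g i (x0 + s *\<^sub>R d)) \<longlongrightarrow> g i x0) (at_right 0)"
          using has_derivative_continuous[OF deriv] line
          by (rule isCont_tendsto_compose)
        ultimately have "\<forall>\<^sub>F s in at_right 0. g i (x0 + s *\<^sub>R d) < 0"
          by (intro order_tendstoD)
        then show ?thesis by eventually_elim simp
      qed simp
    qed
    then have ineqs: "\<forall>\<^sub>F s in at_right (0::real). \<forall>i. i \<in> I \<longrightarrow> g i (x0 + s *\<^sub>R d) \<le> 0"
      by (rule eventually_all_finite)
    have eqs: "g i (x0 + s *\<^sub>R d) = 0" if i: "i \<in> - I" for i s
    proof -
      obtain c b where cb: "\<And>x. g i x = c \<bullet> x + b"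
        using aff[OF i] unfolding affine_fun_def by blast
      have "((\<lambda>x. c \<bullet> x + b) has_derivative (\<lambda>h. h \<bullet> c)) (at x0)"
        by (auto intro!: derivative_eq_intros simp: inner_commute)
      moreover have "g i = (\<lambda>x. c \<bullet> x + b)"
        by (rule ext) (rule cb)
      ultimately have "(g i has_derivative (\<lambda>h. h \<bullet> c)) (at x0)"
        by simp
      then have "(\<lambda>h. h \<bullet> c) = (\<lambda>h. h \<bullet> a i)"
        using deriv by (rule has_derivative_unique)
      then have "d \<bullet> c = d \<bullet> a i" by (rule fun_cong)
      then have "c \<bullet> d = 0" using dB that by (simp add: inner_commute)
      then show ?thesis using feas(2)[OF that] by (simp add: cb inner_add_right)
    qed
    have "\<forall>\<^sub>F s in at_right (0::real). x0 + s *\<^sub>R d \<in> W"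
      using line assms(5,6) by (rule topological_tendstoD)
    moreover have "\<forall>\<^sub>F s in at_right (0::real). s > 0"
      by (simp add: eventually_at_right_less)
    ultimately have "\<forall>\<^sub>F s in at_right (0::real). \<nu> \<bullet> d \<le> 0"
      using ineqs
    proof eventually_elim
      case (elim s)
      then have "\<nu> \<bullet> (x0 + s *\<^sub>R d - x0) \<le> 0"
        using eqs by (intro normal) (auto simp: feasible_set_def)
      with elim(2) show ?case by (simp add: mult_le_0_iff)
    qed
    then show ?thesis by simp
  qed
  then have "\<exists>u. (\<forall>i\<in>A. u i \<ge> 0) \<and> \<nu> = (\<Sum>i\<in>A \<union> - I. u i *\<^sub>R a i)"
    using plicq
    by (intro positive_multipliers_exist)
      (auto simp: positive_LICQ_def active_constraints_def A_def a_def active_ineqs_def)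
  then obtain u where u: "\<forall>i\<in>A. u i \<ge> 0" "\<nu> = (\<Sum>i\<in>A \<union> - I. u i *\<^sub>R a i)"
    by blast
  \<comment> \<open>The multipliers are extended by 0 to the inactive inequalities; this
    complementarity places \<open>w\<close> in the normal cone.\<close>
  define w :: "real^'p" where "w = (\<chi> i. if i \<in> A \<union> - I then u i else 0)"
  have "\<nu> = (\<Sum>i\<in>UNIV. w $ i *\<^sub>R a i)"
    unfolding u(2) by (rule sum.mono_neutral_cong_left) (auto simp: w_def)
  also have "\<dots> = transpose (jacobian (constraint_map g) (at x0)) *v w"
    unfolding a_def by (rule transpose_jacobian_constraint_map[OF C1, symmetric])
  finally have \<nu>: "\<nu> = transpose (jacobian (constraint_map g) (at x0)) *v w" .
  have "w \<in> normal_cone (constraint_cone I) (constraint_map g x0)"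
    unfolding normal_cone_def mem_Collect_eq
  proof (intro conjI ballI)
    show "constraint_map g x0 \<in> constraint_cone I"
      using feas by (auto simp: constraint_map_def constraint_cone_def)
    fix c assume c: "c \<in> constraint_cone I"
    have "w $ i * (c $ i - g i x0) \<le> 0" for i
    proof (cases "i \<in> A")
      case True
      then show ?thesis using u(1) c
        by (auto simp: w_def A_def active_ineqs_def constraint_cone_def mult_le_0_iff)
    next
      case False
      then show ?thesis using c feas
        by (auto simp: w_def constraint_cone_def)
    qed
    then show "w \<bullet> (c - constraint_map g x0) \<le> 0"
      unfolding inner_vec_def constraint_map_def by (intro sum_nonpos) simp
  qed
  with \<nu> show ?thesis unfolding normal_image_def by blast
qed

section \<open>Closedness and local convexity of the feasible set\<close>

lemma closed_feasible_set:
  assumes "\<And>i. C1_fun (g i)"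
  shows "closed (feasible_set g I)"
proof -
  have "continuous_on UNIV (g i)" for i
    using C1_fun_has_derivative[OF assms] has_derivative_continuous
    by (metis continuous_at_imp_continuous_on)
  then show ?thesis
    unfolding feasible_set_def Ball_def
    by (intro closed_Collect_conj closed_Collect_all closed_Collect_imp closed_Collect_le closed_Collect_eq) auto
qed

text \<open>Inactive inequalities remain strict on a small ball and impose nothing there; on that
  ball the active ones are convex and the equalities affine. Finiteness of the index type provides a
  common radius.\<close>

lemma locally_convex_feasible_set:
  fixes g :: "'p::finite \<Rightarrow> real^'n \<Rightarrow> real"
  assumes C1: "\<And>i. C1_fun (g i)"
    and ineq: "\<And>i. i \<in> active_ineqs g I x0 \<Longrightarrow> locally_convex_around (g i) x0"
    and aff: "\<And>i. i \<in> - I \<Longrightarrow> affine_fun (g i)"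
    and "x0 \<in> feasible_set g I"
  shows "\<exists>\<rho>>0. convex (feasible_set g I \<inter> ball x0 \<rho>)"
proof -
  have "\<exists>r>0. (i \<in> active_ineqs g I x0 \<longrightarrow> convex_on (ball x0 r) (g i)) \<and>
      (i \<in> I - active_ineqs g I x0 \<longrightarrow> (\<forall>x\<in>ball x0 r. g i x < 0))" for i
  proof (cases "i \<in> active_ineqs g I x0")
    case True
    then obtain U where U: "open U" "x0 \<in> U" "convex_on U (g i)"
      using ineq unfolding locally_convex_around_def by blast
    then obtain r where "r > 0" "ball x0 r \<subseteq> U" using open_contains_ball by blast
    with True U(3) show ?thesis by (meson DiffD2 convex_ball convex_on_subset)
  next
    case False
    show ?thesis
    proof (cases "i \<in> I")
      case True
      with False assms(4) have "g i x0 < 0"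
        by (fastforce simp: active_ineqs_def feasible_set_def)
      moreover have "isCont (g i) x0"
        using C1_fun_has_derivative[OF C1] by (rule has_derivative_continuous)
      ultimately have "\<forall>\<^sub>F x in nhds x0. g i x < 0"
        unfolding isCont_def tendsto_at_iff_tendsto_nhds by (intro order_tendstoD)
      then obtain r where "r > 0" "\<And>x. dist x x0 < r \<Longrightarrow> g i x < 0"
        unfolding eventually_nhds_metric by blast
      with False show ?thesis by (intro exI[of _ r]) (auto simp: dist_commute)
    qed (use False in \<open>auto intro: exI[of _ 1]\<close>)
  qed
  then obtain r where r: "\<And>i. r i > 0" "\<And>i. i \<in> active_ineqs g I x0 \<Longrightarrow> convex_on (ball x0 (r i)) (g i)"
    "\<And>i x. i \<in> I - active_ineqs g I x0 \<Longrightarrow> x \<in> ball x0 (r i) \<Longrightarrow> g i x < 0"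
    by metis
  define \<rho> where "\<rho> = Min (range r)"
  have \<rho>: "\<rho> > 0" "\<And>i. ball x0 \<rho> \<subseteq> ball x0 (r i)"
    using r(1) by (auto simp: \<rho>_def)
  have "convex (feasible_set g I \<inter> ball x0 \<rho>)"
    unfolding convex_def
  proof (intro ballI allI impI)
    fix x y and u v :: real
    assume x: "x \<in> feasible_set g I \<inter> ball x0 \<rho>" and y: "y \<in> feasible_set g I \<inter> ball x0 \<rho>"
      and uv: "u \<ge> 0" "v \<ge> 0" "u + v = 1"
    have ball: "u *\<^sub>R x + v *\<^sub>R y \<in> ball x0 \<rho>"
      using x y uv convex_ball[of x0 \<rho>] unfolding convex_def by blast
    have "g i (u *\<^sub>R x + v *\<^sub>R y) \<le> 0" if "i \<in> I" for i
    proof (cases "i \<in> active_ineqs g I x0")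
      case True
      have "g i (u *\<^sub>R x + v *\<^sub>R y) \<le> u * g i x + v * g i y"
        using r(2)[OF True] x y uv \<rho>(2)[of i] unfolding convex_on_def by blast
      also have "\<dots> \<le> 0"
        using x y uv that by (intro add_nonpos_nonpos mult_nonneg_nonpos) (auto simp: feasible_set_def)
      finally show ?thesis .
    next
      case False
      with r(3)[of i] that ball \<rho>(2)[of i] show ?thesis by (simp add: less_imp_le subset_iff)
    qed
    moreover have "g i (u *\<^sub>R x + v *\<^sub>R y) = 0" if i: "i \<in> - I" for i
    proof -
      obtain c b where cb: "\<And>x. g i x = c \<bullet> x + b"
        using aff[OF i] unfolding affine_fun_def by blast
      have "g i (u *\<^sub>R x + v *\<^sub>R y) = u * g i x + v * g i y + (1 - (u + v)) * b"
        by (simp add: cb inner_add_right algebra_simps)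
      then show ?thesis using x y uv that by (simp add: feasible_set_def)
    qed
    ultimately show "u *\<^sub>R x + v *\<^sub>R y \<in> feasible_set g I \<inter> ball x0 \<rho>"
      using ball by (simp add: feasible_set_def)
  qed
  with \<rho>(1) show ?thesis by blast
qed

lemma constrained_objective_eq:
  "constrained_objective f g I = (\<lambda>x. f x + indicator_inf (feasible_set g I) x)"
  by (auto simp: fun_eq_iff constrained_objective_def indicator_inf_def feasible_set_def
      constraint_map_def constraint_cone_def)

lemma lsc_fun_add_indicator:
  assumes "lsc_fun f" "\<And>x. f x \<noteq> -\<infinity>" "closed S"
  shows "lsc_fun (\<lambda>x. f x + indicator_inf S x)"
  unfolding lsc_fun_iff
proof (intro allI impI)
  fix x c assume c: "c < f x + indicator_inf S x"
  have f_le: "f y \<le> f y + indicator_inf S y" for y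
    by (simp add: indicator_inf_def)
  show "\<forall>\<^sub>F y in nhds x. c < f y + indicator_inf S y"
  proof (cases "x \<in> S")
    case True
    with c have "c < f x" by (simp add: indicator_inf_def)
    then have "\<forall>\<^sub>F y in nhds x. c < f y" using assms(1) unfolding lsc_fun_iff by blast
    then show ?thesis by eventually_elim (use f_le less_le_trans in blast)
  next
    case False
    then have "\<forall>\<^sub>F y in nhds x. y \<in> - S"
      using assms(3) by (intro eventually_nhds_in_open) auto
    then show ?thesis
    proof eventually_elim
      case (elim y)
      have "c < \<infinity>" using c by auto
      then show ?case using elim assms(2)[of y] by (simp add: indicator_inf_def)
    qed
  qed
qed

theorem theorem5p2:
  fixes f :: "real^'n \<Rightarrow> ereal"
    and g :: "'p::finite \<Rightarrow> real^'n \<Rightarrow> real"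
    and I :: "'p set"
    and x0 :: "real^'n"
  assumes "proper_fun f" and "lsc_fun f"
    and "\<And>i. C1_fun (g i)"
    and critical: "0 \<in> limiting_subdiff (constrained_objective f g I) x0"
    and i_varconvex: "\<And>v. v \<in> limiting_subdiff f x0 \<Longrightarrow> - v \<in> normal_image g I x0
              \<Longrightarrow> variationally_convex f x0 v"
    and ii_PLICQ: "positive_LICQ g I x0"
    and ii_horizon: "horizon_subdiff f x0 \<inter> uminus ` normal_image g I x0 = {0}"
    and iii_ineq: "\<And>i. i \<in> active_ineqs g I x0 \<Longrightarrow> locally_convex_around (g i) x0"
    and iii_eq: "\<And>i. i \<in> - I \<Longrightarrow> affine_fun (g i)"
  shows "variationally_convex (constrained_objective f g I) x0 0 \<and>
         local_minimizer_on f (feasible_set g I) x0"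
proof -
  define S where "S = feasible_set g I"
  define \<phi> where "\<phi> = (\<lambda>x. f x + indicator_inf S x)"
  have \<phi>: "constrained_objective f g I = \<phi>"
    by (simp add: constrained_objective_eq \<phi>_def S_def)
  have f_minf: "f x \<noteq> -\<infinity>" for x
    using assms(1) by (auto simp: proper_fun_def)
  have crit: "0 \<in> limiting_subdiff \<phi> x0" using critical \<phi> by simp
  then have \<phi>_fin: "\<bar>\<phi> x0\<bar> \<noteq> \<infinity>" by (simp add: limiting_subdiff_def)
  then have x0: "x0 \<in> S"
    using f_minf[of x0] by (auto simp: \<phi>_def indicator_inf_def split: if_splits)
  with \<phi>_fin have fin: "\<bar>f x0\<bar> \<noteq> \<infinity>" by (simp add: \<phi>_def indicator_inf_def)
  have closed: "closed S"
    unfolding S_def by (rule closed_feasible_set[OF assms(3)])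
  obtain \<rho> where \<rho>: "\<rho> > 0" "convex (S \<inter> ball x0 \<rho>)"
    using locally_convex_feasible_set[of g I x0, OF assms(3) iii_ineq iii_eq] x0 unfolding S_def by blast
  have normal: "\<nu> \<in> normal_image g I x0" if "\<And>z. z \<in> S \<inter> ball x0 \<rho> \<Longrightarrow> \<nu> \<bullet> (z - x0) \<le> 0" for \<nu>
    using normal_image_if_normal[OF assms(3) ii_PLICQ iii_eq, of "ball x0 \<rho>" \<nu>] that x0 \<rho>(1)
    unfolding S_def by simp
  obtain \<delta> where \<delta>: "\<delta> > 0"
    "\<And>x w y. \<lbrakk>w \<in> limiting_subdiff \<phi> x; norm (x - x0) < \<delta>; \<phi> x < \<phi> x0 + ereal \<delta>; norm w < \<delta>;
       norm (y - x0) < \<delta>\<rbrakk> \<Longrightarrow> \<phi> x + ereal (w \<bullet> (y - x)) \<le> \<phi> y"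
    using sum_indicator_subgradient_inequality[OF assms(2) f_minf fin closed x0 open_ball _ \<rho>(2)
        i_varconvex _ normal] \<rho>(1) ii_horizon unfolding \<phi>_def by auto
  have "\<phi> x \<noteq> -\<infinity>" for x
    using f_minf[of x] by (simp add: \<phi>_def indicator_inf_def)
  moreover have "\<phi> x0 \<noteq> \<infinity>" using \<phi>_fin by auto
  ultimately have "proper_fun \<phi>"
    unfolding proper_fun_def by (intro conjI allI exI[of _ x0]) simp_all
  moreover have "lsc_fun \<phi>"
    unfolding \<phi>_def by (rule lsc_fun_add_indicator[OF assms(2) f_minf closed])
  ultimately have "variationally_convex \<phi> x0 0"
    using crit \<delta> by (rule variationally_convexI)
  \<comment> \<open>The inequality for the subgradient 0 at \<open>x0\<close> is already local
    minimality of \<open>\<phi>\<close>, and \<open>\<phi>\<close> coincides with \<open>f\<close>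
    on \<open>S\<close>.\<close>
  moreover have "local_minimizer_on f S x0"
    unfolding local_minimizer_on_def
  proof (intro conjI exI ballI)
    show "x0 \<in> dom_fun f" using fin by (auto simp: dom_fun_def)
    fix y assume y: "y \<in> ball x0 \<delta> \<inter> S"
    have "\<phi> x0 < \<phi> x0 + ereal \<delta>" using \<phi>_fin \<delta>(1) by (cases "\<phi> x0") auto
    then have "\<phi> x0 + ereal (0 \<bullet> (y - x0)) \<le> \<phi> y"
      using y \<delta>(1) by (intro \<delta>(2) crit) (auto simp: dist_norm norm_minus_commute)
    then show "f x0 \<le> f y" using y x0 by (simp add: \<phi>_def indicator_inf_def)
  qed (use x0 \<delta>(1) in auto)
  ultimately show ?thesis by (simp add: \<phi> S_def)
qed

end
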